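(* Let $k\ge 0$ and $l\ge 1$ be integers and, for every $q\in\mathbb{C}\setminus\{0\}$ with $(1)_q(2)_q\cdots(k+l)_q\neq 0$, let $$\mathcal{H}_{(k,l)}(q)=\rho_{(k,l)}\Big(\sum_{i=1}^{k+l}\sigma_i\Big)-(qk-q^{-1}l)\,\mathbf{1}\in \mathrm{End}(V_{(k,l)}),$$ where $\rho_{(k,l)}$ is the corner representation of the Hecke algebra $H_{k+l+1}$ for the Young diagram $\{k+1,1^l\}$. Then the family $\mathcal{H}_{(k,l)}(q)$ is isospectral (its spectrum does not depend on $q$), and $$\mathrm{Spec}\big(\mathcal{H}_{(k,l)}(q)\big)=\Big\{\sum_{i=1}^{l}2\cos\frac{\pi m_i}{k+l+1}\ :\ 1\le m_1<m_2<\dots<m_l\le k+l\Big\},$$ where $m_1,\dots,m_l$ are integers.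
   Context: For $q\in\mathbb{C}\setminus\{0\}$ and an integer $p\ge 0$, $(p)_q=\frac{q^p-q^{-p}}{q-q^{-1}}=\sum_{j=0}^{p-1}q^{p-1-2j}$ (the last expression is used when $q^2=1$); $(0)_q=0$. The Hecke algebra $H_{n+1}$ (with parameter $q$) is the unital associative $\mathbb{C}$-algebra generated by $\sigma_1,\dots,\sigma_n$ with relations $\sigma_i\sigma_{i+1}\sigma_i=\sigma_{i+1}\sigma_i\sigma_{i+1}$, $\sigma_i\sigma_j=\sigma_j\sigma_i$ for $|i-j|>1$, $\sigma_i^2=(q-q^{-1})\sigma_i+1$. Corner representation $\rho_{(k,l)}$ of $H_{k+l+1}$ (diagram $\{k+1,1^l\}$, i.e. first row of length $k+1$ and $l$ further rows of length 1): its space $V_{(k,l)}$ is the complex vector space with basis $v_I$ indexed by the $l$-element subsets $I\subset\{2,3,\dots,k+l+1\}$ (such $I$ is the set of first-column entries other than 1 of a standard Young tableau). For $1\le p\le k+l$: $\rho_{(k,l)}(\sigma_p)v_I=q\,v_I$ if $p,p+1\notin I$; $\rho_{(k,l)}(\sigma_p)v_I=-\frac{q^{-p}}{(p)_q}v_I+\frac{(p-1)_q}{(p)_q}v_{s_pI}$ if $p\notin I$, $p+1\in I$; $\rho_{(k,l)}(\sigma_p)v_I=\frac{q^{p}}{(p)_q}v_I+\frac{(p+1)_q}{(p)_q}v_{s_pI}$ if $p\in I$, $p+1\notin I$; $\rho_{(k,l)}(\sigma_p)v_I=-q^{-1}v_I$ if $p,p+1\in I$. Here $s_pI$ is obtained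 from $I$ by interchanging the numbers $p$ and $p+1$ (for $p=1$ the term with $v_{s_pI}$ has coefficient $(0)_q=0$ and is omitted). *)

theory Defs
  imports Complex_Main "HOL-Algebra.Module" "HOL-Combinatorics.Transposition"
begin

section \<open>Complex algebras given by generators and relations\<close>

datatype (gens: 'g) alg_term =
    AGen 'g
  | AZero
  | AOne
  | AScale complex "'g alg_term"
  | APlus "'g alg_term" "'g alg_term"
  | ATimes "'g alg_term" "'g alg_term"

inductive alg_axiom :: "'g alg_term \<Rightarrow> 'g alg_term \<Rightarrow> bool" where
  plus_assoc: "alg_axiom (APlus (APlus a b) c) (APlus a (APlus b c))"
| plus_comm: "alg_axiom (APlus a b) (APlus b a)"
| plus_zero: "alg_axiom (APlus AZero a) a"
| plus_minus: "alg_axiom (APlus (AScale (-1) a) a) AZero"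
| times_assoc: "alg_axiom (ATimes (ATimes a b) c) (ATimes a (ATimes b c))"
| one_times: "alg_axiom (ATimes AOne a) a"
| times_one: "alg_axiom (ATimes a AOne) a"
| distrib_right: "alg_axiom (ATimes (APlus a b) c) (APlus (ATimes a c) (ATimes b c))"
| distrib_left: "alg_axiom (ATimes a (APlus b c)) (APlus (ATimes a b) (ATimes a c))"
| scale_plus: "alg_axiom (AScale x (APlus a b)) (APlus (AScale x a) (AScale x b))"
| plus_scale: "alg_axiom (AScale (x + y) a) (APlus (AScale x a) (AScale y a))"
| scale_scale: "alg_axiom (AScale x (AScale y a)) (AScale (x * y) a)"
| scale_one: "alg_axiom (AScale 1 a) a"
| scale_times: "alg_axiom (ATimes (AScale x a) b) (AScale x (ATimes a b))"
| times_scale: "alg_axiom (ATimes a (AScale x b)) (AScale x (ATimes a b))"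

definition alg_terms :: "'g set \<Rightarrow> 'g alg_term set" where
  "alg_terms G = {t. gens t \<subseteq> G}"

inductive_set alg_cong :: "'g set \<Rightarrow> ('g alg_term \<times> 'g alg_term) set \<Rightarrow> ('g alg_term \<times> 'g alg_term) set"
  for G R where
  "alg_axiom": "\<lbrakk>alg_axiom s t; s \<in> alg_terms G; t \<in> alg_terms G\<rbrakk> \<Longrightarrow> (s, t) \<in> alg_cong G R"
| relation: "\<lbrakk>(s, t) \<in> R; s \<in> alg_terms G; t \<in> alg_terms G\<rbrakk> \<Longrightarrow> (s, t) \<in> alg_cong G R"
| refl: "s \<in> alg_terms G \<Longrightarrow> (s, s) \<in> alg_cong G R"
| sym: "(s, t) \<in> alg_cong G R \<Longrightarrow> (t, s) \<in> alg_cong G R"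
| trans: "\<lbrakk>(s, t) \<in> alg_cong G R; (t, u) \<in> alg_cong G R\<rbrakk> \<Longrightarrow> (s, u) \<in> alg_cong G R"
| scale: "(s, t) \<in> alg_cong G R \<Longrightarrow> (AScale x s, AScale x t) \<in> alg_cong G R"
| plus: "\<lbrakk>(s, t) \<in> alg_cong G R; (s', t') \<in> alg_cong G R\<rbrakk>
    \<Longrightarrow> (APlus s s', APlus t t') \<in> alg_cong G R"
| times: "\<lbrakk>(s, t) \<in> alg_cong G R; (s', t') \<in> alg_cong G R\<rbrakk>
    \<Longrightarrow> (ATimes s s', ATimes t t') \<in> alg_cong G R"

definition alg_class :: "'g set \<Rightarrow> ('g alg_term \<times> 'g alg_term) set \<Rightarrow> 'g alg_term \<Rightarrow> 'g alg_term set"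
  where "alg_class G R t = alg_cong G R `` {t}"

text \<open>Elements are congruence classes of terms whose generators lie in \<open>G\<close>; the unions below
  range over all representatives and are constant by \<open>presented_ops\<close>.\<close>

definition presented_algebra ::
    "'g set \<Rightarrow> ('g alg_term \<times> 'g alg_term) set \<Rightarrow> (complex, 'g alg_term set) module" where
  "presented_algebra G R =
    \<lparr>carrier = alg_terms G // alg_cong G R,
     mult = (\<lambda>X Y. \<Union>s\<in>X. \<Union>t\<in>Y. alg_class G R (ATimes s t)),
     one = alg_class G R AOne,
     zero = alg_class G R AZero,
     add = (\<lambda>X Y. \<Union>s\<in>X. \<Union>t\<in>Y. alg_class G R (APlus s t)),
     smult = (\<lambda>x X. \<Union>s\<in>X. alg_class G R (AScale x s))\<rparr>"

lemma equiv_alg_cong: "equiv (alg_terms G) (alg_cong G R)"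
proof (rule equivI)
  have "s \<in> alg_terms G \<and> t \<in> alg_terms G" if "(s, t) \<in> alg_cong G R" for s t
    using that by induction (auto simp: alg_terms_def)
  then show "alg_cong G R \<subseteq> alg_terms G \<times> alg_terms G"
    by auto
  show "refl_on (alg_terms G) (alg_cong G R)"
    by (auto simp: refl_on_def intro: alg_cong.refl)
  show "Relation.sym (alg_cong G R)"
    by (auto simp: sym_def intro: alg_cong.sym)
  show "Relation.trans (alg_cong G R)"
    by (auto simp: trans_def intro: alg_cong.trans)
qed

lemma alg_congD:
  assumes "(s, t) \<in> alg_cong G R"
  shows "s \<in> alg_terms G" "t \<in> alg_terms G"
  using assms equiv_type[OF equiv_alg_cong, of G R] by auto

lemma alg_terms_simps [simp]:
  "AGen g \<in> alg_terms G \<longleftrightarrow> g \<in> G"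
  "AZero \<in> alg_terms G"
  "AOne \<in> alg_terms G"
  "AScale x s \<in> alg_terms G \<longleftrightarrow> s \<in> alg_terms G"
  "APlus s t \<in> alg_terms G \<longleftrightarrow> s \<in> alg_terms G \<and> t \<in> alg_terms G"
  "ATimes s t \<in> alg_terms G \<longleftrightarrow> s \<in> alg_terms G \<and> t \<in> alg_terms G"
  by (auto simp: alg_terms_def)

lemma alg_class_eq_iff:
  assumes "s \<in> alg_terms G" "t \<in> alg_terms G"
  shows "alg_class G R s = alg_class G R t \<longleftrightarrow> (s, t) \<in> alg_cong G R"
  unfolding alg_class_def using eq_equiv_class_iff[OF equiv_alg_cong assms] .

lemma alg_class_carrier:
  "s \<in> alg_terms G \<Longrightarrow> alg_class G R s \<in> carrier (presented_algebra G R)"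
  by (simp add: presented_algebra_def alg_class_def quotientI)

lemma presented_carrierE:
  assumes "X \<in> carrier (presented_algebra G R)"
  obtains s where "s \<in> alg_terms G" "X = alg_class G R s"
  using assms by (auto simp: presented_algebra_def alg_class_def elim: quotientE)

lemma presented_ops:
  assumes "s \<in> alg_terms G" "t \<in> alg_terms G"
  shows "alg_class G R s \<otimes>\<^bsub>presented_algebra G R\<^esub> alg_class G R t = alg_class G R (ATimes s t)"
    and "alg_class G R s \<oplus>\<^bsub>presented_algebra G R\<^esub> alg_class G R t = alg_class G R (APlus s t)"
    and "x \<odot>\<^bsub>presented_algebra G R\<^esub> alg_class G R s = alg_class G R (AScale x s)"
proof -
  have mem: "u \<in> alg_class G R u" if "u \<in> alg_terms G" for u
    using that by (auto simp: alg_class_def intro: alg_cong.refl)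
  have mult: "alg_class G R (ATimes s' t') = alg_class G R (ATimes s t)"
    if "s' \<in> alg_class G R s" "t' \<in> alg_class G R t" for s' t'
    using that assms
    by (subst alg_class_eq_iff)
      (auto simp: alg_class_def dest: alg_congD intro!: alg_cong.times intro: alg_cong.sym)
  have plus: "alg_class G R (APlus s' t') = alg_class G R (APlus s t)"
    if "s' \<in> alg_class G R s" "t' \<in> alg_class G R t" for s' t'
    using that assms
    by (subst alg_class_eq_iff)
      (auto simp: alg_class_def dest: alg_congD intro!: alg_cong.plus intro: alg_cong.sym)
  have scale: "alg_class G R (AScale x s') = alg_class G R (AScale x s)"
    if "s' \<in> alg_class G R s" for s'
    using that assms
    by (subst alg_class_eq_iff)
      (auto simp: alg_class_def dest: alg_congD intro!: alg_cong.scale intro: alg_cong.sym)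
  show "alg_class G R s \<otimes>\<^bsub>presented_algebra G R\<^esub> alg_class G R t = alg_class G R (ATimes s t)"
    unfolding presented_algebra_def monoid.simps ring.simps
    by (intro UN_constant_eq[OF mem[OF assms(1)]] UN_constant_eq[OF mem[OF assms(2)]] ballI mult)
  show "alg_class G R s \<oplus>\<^bsub>presented_algebra G R\<^esub> alg_class G R t = alg_class G R (APlus s t)"
    unfolding presented_algebra_def monoid.simps ring.simps
    by (intro UN_constant_eq[OF mem[OF assms(1)]] UN_constant_eq[OF mem[OF assms(2)]] ballI plus)
  show "x \<odot>\<^bsub>presented_algebra G R\<^esub> alg_class G R s = alg_class G R (AScale x s)"
    unfolding presented_algebra_def module.simps
    by (intro UN_constant_eq[OF mem[OF assms(1)]] ballI scale)
qed

lemma presented_zero_one: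
  "\<zero>\<^bsub>presented_algebra G R\<^esub> = alg_class G R AZero"
  "\<one>\<^bsub>presented_algebra G R\<^esub> = alg_class G R AOne"
  by (simp_all add: presented_algebra_def)

lemma alg_class_axiom:
  assumes "alg_axiom s t" "s \<in> alg_terms G" "t \<in> alg_terms G"
  shows "alg_class G R s = alg_class G R t"
  using assms by (simp add: alg_class_eq_iff alg_cong.alg_axiom)

lemma presented_algebra_ring: "ring (presented_algebra G R)"
proof (rule ringI)
  let ?A = "presented_algebra G R"
  note ops = presented_ops presented_zero_one
  show "abelian_group ?A"
  proof (rule abelian_groupI)
    fix X assume "X \<in> carrier ?A"
    then obtain s where s: "s \<in> alg_terms G" "X = alg_class G R s" by (rule presented_carrierE)
    have "alg_class G R (AScale (-1) s) \<oplus>\<^bsub>?A\<^esub> X = \<zero>\<^bsub>?A\<^esub>"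
      using s by (simp add: ops) (rule alg_class_axiom[OF alg_axiom.plus_minus], simp_all)
    then show "\<exists>Y\<in>carrier ?A. Y \<oplus>\<^bsub>?A\<^esub> X = \<zero>\<^bsub>?A\<^esub>"
      using s alg_class_carrier by (metis alg_terms_simps(4))
  next
    fix X Y Z assume "X \<in> carrier ?A" "Y \<in> carrier ?A" "Z \<in> carrier ?A"
    then show "X \<oplus>\<^bsub>?A\<^esub> Y \<oplus>\<^bsub>?A\<^esub> Z = X \<oplus>\<^bsub>?A\<^esub> (Y \<oplus>\<^bsub>?A\<^esub> Z)"
      by (elim presented_carrierE) (simp add: ops alg_class_axiom[OF alg_axiom.plus_assoc])
  next
    fix X Y assume "X \<in> carrier ?A" "Y \<in> carrier ?A"
    then show "X \<oplus>\<^bsub>?A\<^esub> Y = Y \<oplus>\<^bsub>?A\<^esub> X"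
      by (elim presented_carrierE) (simp add: ops, rule alg_class_axiom[OF alg_axiom.plus_comm], simp_all)
  next
    fix X assume "X \<in> carrier ?A"
    then show "\<zero>\<^bsub>?A\<^esub> \<oplus>\<^bsub>?A\<^esub> X = X"
      by (elim presented_carrierE) (simp add: ops alg_class_axiom[OF alg_axiom.plus_zero])
  qed (auto elim!: presented_carrierE simp: ops alg_class_carrier)
  show "Group.monoid ?A"
    by (rule Group.monoidI)
      (auto elim!: presented_carrierE simp: ops alg_class_carrier
        alg_class_axiom[OF alg_axiom.times_assoc] alg_class_axiom[OF alg_axiom.one_times]
        alg_class_axiom[OF alg_axiom.times_one])
next
  let ?A = "presented_algebra G R"
  fix X Y Z assume "X \<in> carrier ?A" "Y \<in> carrier ?A" "Z \<in> carrier ?A"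
  then show "(X \<oplus>\<^bsub>?A\<^esub> Y) \<otimes>\<^bsub>?A\<^esub> Z = X \<otimes>\<^bsub>?A\<^esub> Z \<oplus>\<^bsub>?A\<^esub> Y \<otimes>\<^bsub>?A\<^esub> Z"
    and "Z \<otimes>\<^bsub>?A\<^esub> (X \<oplus>\<^bsub>?A\<^esub> Y) = Z \<otimes>\<^bsub>?A\<^esub> X \<oplus>\<^bsub>?A\<^esub> Z \<otimes>\<^bsub>?A\<^esub> Y"
    by (elim presented_carrierE,
        simp add: presented_ops alg_class_axiom[OF alg_axiom.distrib_left]
          alg_class_axiom[OF alg_axiom.distrib_right])+
qed

primrec alg_eval :: "('g \<Rightarrow> ('i \<Rightarrow> complex) \<Rightarrow> 'i \<Rightarrow> complex) \<Rightarrow> 'g alg_term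
    \<Rightarrow> ('i \<Rightarrow> complex) \<Rightarrow> 'i \<Rightarrow> complex" where
  "alg_eval T (AGen g) = T g"
| "alg_eval T AZero = (\<lambda>f i. 0)"
| "alg_eval T AOne = (\<lambda>f. f)"
| "alg_eval T (AScale x s) = (\<lambda>f i. x * alg_eval T s f i)"
| "alg_eval T (APlus s t) = (\<lambda>f i. alg_eval T s f i + alg_eval T t f i)"
| "alg_eval T (ATimes s t) = (\<lambda>f. alg_eval T s (alg_eval T t f))"

lemma alg_eval_linear:
  assumes "\<And>g f h x y. T g (\<lambda>i. x * f i + y * h i) = (\<lambda>i. x * T g f i + y * T g h i)"
  shows "alg_eval T s (\<lambda>i. x * f i + y * h i) = (\<lambda>i. x * alg_eval T s f i + y * alg_eval T s h i)"
  by (induction s arbitrary: f h) (simp_all add: assms algebra_simps)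

lemma alg_eval_cong:
  assumes lin: "\<And>g f h x y. T g (\<lambda>i. x * f i + y * h i) = (\<lambda>i. x * T g f i + y * T g h i)"
    and V: "\<And>g f. g \<in> G \<Longrightarrow> f \<in> V \<Longrightarrow> T g f \<in> V"
      "(\<lambda>i. 0) \<in> V" "\<And>f h x y. f \<in> V \<Longrightarrow> h \<in> V \<Longrightarrow> (\<lambda>i. x * f i + y * h i) \<in> V"
    and R: "\<And>s t f. (s, t) \<in> R \<Longrightarrow> f \<in> V \<Longrightarrow> alg_eval T s f = alg_eval T t f"
    and st: "(s, t) \<in> alg_cong G R" and f: "f \<in> V"
  shows "alg_eval T s f = alg_eval T t f"
proof -
  note l = alg_eval_linear[of T, OF lin]
  have l1: "alg_eval T s (\<lambda>i. f i + h i) = (\<lambda>i. alg_eval T s f i + alg_eval T s h i)" for s f h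
    using l[of s 1 f 1 h] by simp
  have l2: "alg_eval T s (\<lambda>i. x * f i) = (\<lambda>i. x * alg_eval T s f i)" for s f x
    using l[of s x f 0 f] by simp
  have closed: "alg_eval T s f \<in> V" if "s \<in> alg_terms G" "f \<in> V" for s f
    using that
  proof (induction s arbitrary: f)
    case (AScale x s)
    then show ?case using V(3)[of "alg_eval T s f" "alg_eval T s f" x 0] by simp
  next
    case (APlus s t)
    then show ?case using V(3)[of "alg_eval T s f" "alg_eval T t f" 1 1] by simp
  qed (use V in auto)
  show ?thesis
    using st f
  proof (induction arbitrary: f)
    case (alg_axiom s t)
    from alg_axiom(1) show ?case
      by cases (simp_all add: l1 l2 algebra_simps)
  next
    case (times s t s' t')
    then show ?case using closed[of s' f] alg_congD by force
  qed (simp_all add: R)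
qed


section \<open>The Hecke algebra\<close>

text \<open>\<open>hecke n q\<close> is the algebra usually written $H_{n+1}$: it has \<open>n\<close> generators.\<close>

definition hecke_relations :: "nat \<Rightarrow> complex \<Rightarrow> (nat alg_term \<times> nat alg_term) set" where
  "hecke_relations n q =
     {(ATimes (ATimes (AGen i) (AGen (i + 1))) (AGen i),
       ATimes (ATimes (AGen (i + 1)) (AGen i)) (AGen (i + 1))) | i. 1 \<le> i \<and> i + 1 \<le> n}
   \<union> {(ATimes (AGen i) (AGen j), ATimes (AGen j) (AGen i)) | i j.
       i \<in> {1..n} \<and> j \<in> {1..n} \<and> \<bar>int i - int j\<bar> > 1}
   \<union> {(ATimes (AGen i) (AGen i), APlus (AScale (q - inverse q) (AGen i)) AOne) | i. i \<in> {1..n}}"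

definition hecke :: "nat \<Rightarrow> complex \<Rightarrow> (complex, nat alg_term set) module" where
  "hecke n q = presented_algebra {1..n} (hecke_relations n q)"

definition hecke_gen :: "nat \<Rightarrow> complex \<Rightarrow> nat \<Rightarrow> nat alg_term set" where
  "hecke_gen n q i = alg_class {1..n} (hecke_relations n q) (AGen i)"



section \<open>The corner representation\<close>

text \<open>The sum also covers $q^2 = 1$; for the quotient form see \<open>qnum_eq_quotient\<close>.\<close>

definition qnum :: "complex \<Rightarrow> nat \<Rightarrow> complex" where
  "qnum q p = (\<Sum>j<p. q powi (int p - 1 - 2 * int j))"

lemma qnum_0 [simp]: "qnum q 0 = 0"
  by (simp add: qnum_def)

lemma qnum_Suc:
  assumes "q \<noteq> 0"
  shows "qnum q (Suc p) = q * qnum q p + q powi (- int p)"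
proof -
  have "q powi (int (Suc p) - 1 - 2 * int j) = q * q powi (int p - 1 - 2 * int j)" for j
    using power_int_add_1'[of q "int p - 1 - 2 * int j"] assms by (simp add: algebra_simps)
  moreover have "q powi (int (Suc p) - 1 - 2 * int p) = q powi (- int p)"
    by (simp add: algebra_simps)
  ultimately show ?thesis
    by (simp only: qnum_def sum.lessThan_Suc sum_distrib_left)
qed

lemma powi_Suc:
  assumes "q \<noteq> 0"
  shows "(q :: complex) powi int (Suc p) = q * q powi int p"
    and "q powi (- int (Suc p)) = q powi (- int p) / q"
  using assms by (simp_all add: power_int_minus field_simps del: of_nat_Suc)

lemma qnum_diff:
  assumes "q \<noteq> 0"
  shows "(q - inverse q) * qnum q p = q powi int p - q powi (- int p)"
proof (induction p)
  case (Suc p)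
  have "q powi int (Suc p) = q * q powi int p" "q powi (- int (Suc p)) = q powi (- int p) / q"
    using assms by (rule powi_Suc)+
  moreover have "(q - inverse q) * qnum q (Suc p)
      = q * ((q - inverse q) * qnum q p) + (q - inverse q) * q powi (- int p)"
    using assms by (simp add: qnum_Suc algebra_simps)
  ultimately show ?case
    using assms unfolding Suc.IH by (simp add: field_simps del: of_nat_Suc)
qed simp

lemma qnum_eq_quotient:
  assumes "q \<noteq> 0" "q\<^sup>2 \<noteq> 1"
  shows "qnum q p = (q powi int p - q powi (- int p)) / (q - inverse q)"
proof -
  have "q - inverse q \<noteq> 0"
    using assms by (auto simp: field_simps power2_eq_square)
  then show ?thesis
    using qnum_diff[OF assms(1), of p] by (simp add: field_simps)
qed

definition corner_index :: "nat \<Rightarrow> nat \<Rightarrow> nat set set" where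
  "corner_index k l = {I. I \<subseteq> {2..k + l + 1} \<and> card I = l}"

text \<open>The space with basis indexed by \<open>corner_index k l\<close>, realised as the complex functions on
  sets that vanish outside \<open>corner_index k l\<close>.\<close>

definition corner_space :: "nat \<Rightarrow> nat \<Rightarrow> (nat set \<Rightarrow> complex) set" where
  "corner_space k l = {f. \<forall>I. I \<notin> corner_index k l \<longrightarrow> f I = 0}"

definition bvec :: "nat set \<Rightarrow> nat set \<Rightarrow> complex" where
  "bvec I = (\<lambda>J. if J = I then 1 else 0)"

definition sswap :: "nat \<Rightarrow> nat set \<Rightarrow> nat set" where
  "sswap p I = Transposition.transpose p (p + 1) ` I"

text \<open>The image of the basis vector \<open>bvec I\<close> under the \<open>p\<close>-th generator. For \<open>p = 1\<close> the set
  \<open>sswap p I\<close> may contain 1 and so lie outside \<open>corner_index k l\<close>; its coefficient is then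
  \<open>qnum q 0 = 0\<close>.\<close>

definition corner_act :: "complex \<Rightarrow> nat \<Rightarrow> nat set \<Rightarrow> nat set \<Rightarrow> complex" where
  "corner_act q p I =
    (if p \<notin> I \<and> p + 1 \<notin> I then
       (\<lambda>J. q * bvec I J)
     else if p \<notin> I \<and> p + 1 \<in> I then
       (\<lambda>J. - (q powi (- int p) / qnum q p) * bvec I J
            + qnum q (p - 1) / qnum q p * bvec (sswap p I) J)
     else if p \<in> I \<and> p + 1 \<notin> I then
       (\<lambda>J. q powi int p / qnum q p * bvec I J
            + qnum q (p + 1) / qnum q p * bvec (sswap p I) J)
     else
       (\<lambda>J. - inverse q * bvec I J))"

definition corner_op :: "nat \<Rightarrow> nat \<Rightarrow> complex \<Rightarrow> nat \<Rightarrow> (nat set \<Rightarrow> complex) \<Rightarrow> nat set \<Rightarrow> complex" where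
  "corner_op k l q p f = (\<lambda>J. \<Sum>I\<in>corner_index k l. f I * corner_act q p I J)"

definition corner_admissible :: "nat \<Rightarrow> nat \<Rightarrow> complex \<Rightarrow> bool" where
  "corner_admissible k l q \<longleftrightarrow> q \<noteq> 0 \<and> (\<Prod>p=1..k + l. qnum q p) \<noteq> 0"

text \<open>The representation applied to an element of the Hecke algebra, that is, to a class of terms.
  Lemma \<open>corner_rep_class\<close> below shows that the choice of the representative does not matter.\<close>

definition corner_rep :: "nat \<Rightarrow> nat \<Rightarrow> complex \<Rightarrow> nat alg_term set
    \<Rightarrow> (nat set \<Rightarrow> complex) \<Rightarrow> nat set \<Rightarrow> complex" where
  "corner_rep k l q X = (\<lambda>f\<in>corner_space k l. alg_eval (corner_op k l q) (SOME t. t \<in> X) f)"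

lemma in_sswap_iff:
  "x \<in> sswap p J \<longleftrightarrow> (if x = p then p + 1 \<in> J else if x = p + 1 then p \<in> J else x \<in> J)"
  by (auto simp: sswap_def in_transpose_image_iff Transposition.transpose_def)

lemma sswap_sswap [simp]: "sswap p (sswap p J) = J"
  by (auto simp: in_sswap_iff split: if_splits)

lemma eq_sswap_iff: "J = sswap p I \<longleftrightarrow> I = sswap p J"
  by auto

lemma sswap_id: "p \<in> J \<longleftrightarrow> p + 1 \<in> J \<Longrightarrow> sswap p J = J"
  by (auto simp: in_sswap_iff split: if_splits)

lemma finite_corner_index: "finite (corner_index k l)"
  by (rule finite_subset[of _ "Pow {2..k + l + 1}"]) (auto simp: corner_index_def)

text \<open>Coordinate formula for \<open>corner_op\<close>, see \<open>corner_op_coord\<close>.\<close>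

definition corner_coord :: "complex \<Rightarrow> nat \<Rightarrow> (nat set \<Rightarrow> complex) \<Rightarrow> nat set \<Rightarrow> complex" where
  "corner_coord q p f J =
    (if p \<notin> J \<and> p + 1 \<notin> J then q * f J
     else if p \<notin> J \<and> p + 1 \<in> J then
       - (q powi (- int p) / qnum q p) * f J + qnum q (p + 1) / qnum q p * f (sswap p J)
     else if p \<in> J \<and> p + 1 \<notin> J then
       q powi int p / qnum q p * f J + qnum q (p - 1) / qnum q p * f (sswap p J)
     else - inverse q * f J)"

lemma corner_op_coord:
  assumes f: "f \<in> corner_space k l"
  shows "corner_op k l q p f = corner_coord q p f"
proof
  fix J
  define ca where "ca I = (if p \<notin> I \<and> p + 1 \<notin> I then q
    else if p \<notin> I \<and> p + 1 \<in> I then - (q powi (- int p) / qnum q p)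
    else if p \<in> I \<and> p + 1 \<notin> I then q powi int p / qnum q p else - inverse q)" for I
  define cb where "cb I = (if p \<notin> I \<and> p + 1 \<in> I then qnum q (p - 1) / qnum q p
    else if p \<in> I \<and> p + 1 \<notin> I then qnum q (p + 1) / qnum q p else 0)" for I
  have act: "corner_act q p I J = ca I * bvec I J + cb I * bvec (sswap p I) J" for I
    by (auto simp: corner_act_def ca_def cb_def)
  have "corner_op k l q p f J
      = (\<Sum>I\<in>corner_index k l. if I = J then ca J * f J else 0)
      + (\<Sum>I\<in>corner_index k l. if I = sswap p J then cb (sswap p J) * f (sswap p J) else 0)"
    unfolding corner_op_def act sum.distrib[symmetric]
    by (rule sum.cong) (auto simp: bvec_def algebra_simps)
  also have "\<dots> = ca J * f J + cb (sswap p J) * f (sswap p J)"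
    using f finite_corner_index by (auto simp: corner_space_def)
  also have "\<dots> = corner_coord q p f J"
    by (auto simp: ca_def cb_def corner_coord_def in_sswap_iff)
  finally show "corner_op k l q p f J = corner_coord q p f J" .
qed

lemma sswap_index:
  assumes "p \<in> {2..k + l}" "J \<in> corner_index k l"
  shows "sswap p J \<in> corner_index k l"
proof -
  have "card (sswap p J) = card J"
    unfolding sswap_def by (rule card_image) simp
  moreover have "sswap p J \<subseteq> {2..k + l + 1}"
    using assms by (auto simp: in_sswap_iff corner_index_def split: if_splits)
  ultimately show ?thesis
    using assms by (simp add: corner_index_def)
qed

lemma corner_op_closed:
  assumes p: "p \<in> {1..k + l}" and f: "f \<in> corner_space k l"
  shows "corner_op k l q p f \<in> corner_space k l"
proof -
  have "corner_coord q p f J = 0" if J: "J \<notin> corner_index k l" for J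
  proof (cases "p = 1")
    case True
    have "f (sswap p J) = 0" if "p \<notin> J"  "p + 1 \<in> J"
    proof -
      have "1 \<in> sswap p J" using that True by (simp add: in_sswap_iff)
      then have "sswap p J \<notin> corner_index k l" by (auto simp: corner_index_def)
      then show ?thesis using f by (simp add: corner_space_def)
    qed
    then show ?thesis
      using f J True by (auto simp: corner_space_def corner_coord_def)
  next
    case False
    then have "sswap p J \<notin> corner_index k l"
      using J p sswap_index[of p k l "sswap p J"] by auto
    then show ?thesis
      using f J by (simp add: corner_space_def corner_coord_def)
  qed
  then show ?thesis
    unfolding corner_op_coord[OF f] by (simp add: corner_space_def)
qed

lemma corner_op_linear:
  "corner_op k l q p (\<lambda>i. x * f i + y * h i)
    = (\<lambda>i. x * corner_op k l q p f i + y * corner_op k l q p h i)"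
  by (simp add: corner_op_def sum.distrib sum_distrib_left algebra_simps)

lemma corner_coeffs:
  fixes q :: complex and al be ga de :: "nat \<Rightarrow> complex"
  defines "al \<equiv> \<lambda>p. - (q powi (- int p) / qnum q p)"
    and "be \<equiv> \<lambda>p. qnum q (p + 1) / qnum q p"
    and "ga \<equiv> \<lambda>p. q powi int p / qnum q p"
    and "de \<equiv> \<lambda>p. qnum q (p - 1) / qnum q p"
  assumes q: "q \<noteq> 0" and p: "p \<ge> 1" and x: "qnum q p \<noteq> 0"
  shows "al p = q - inverse q - ga p"
    and "be p * de p = 1 + (q - inverse q) * ga p - ga p * ga p"
    and "qnum q (p + 1) \<noteq> 0 \<Longrightarrow> ga (p + 1) * (inverse q + ga p) = q * ga p"
proof -
  obtain r where r: "p = Suc r"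
    using p by (cases p) auto
  define w u where "w = q powi (- int p)" and "u = q powi int p"
  have uw: "u * w = 1"
    using q by (simp add: u_def w_def power_int_minus)
  have diff: "(q - inverse q) * qnum q p = u - w"
    using qnum_diff[OF q] by (simp add: u_def w_def)
  have up: "qnum q (p + 1) = q * qnum q p + w"
    using qnum_Suc[OF q, of p] by (simp add: w_def)
  have "w = q powi (- int r) / q"
    unfolding w_def r by (rule powi_Suc[OF q])
  then have down: "qnum q (p - 1) = qnum q p / q - w"
    using qnum_Suc[OF q, of r] q by (simp add: r field_simps)
  have ga_Suc: "ga (p + 1) = q * u / qnum q (p + 1)"
    using powi_Suc(1)[OF q, of p] by (simp only: ga_def u_def Suc_eq_plus1)
  have 1: "al p = - (w / qnum q p)" "ga p = u / qnum q p"
    by (simp_all add: al_def ga_def u_def w_def)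
  show "al p = q - inverse q - ga p"
    using diff x unfolding 1 by (simp add: divide_simps)
  define Q where "Q = inverse q"
  have "Q * q = 1"
    using q by (simp add: Q_def)
  have "qnum q (p + 1) * qnum q (p - 1)
      = qnum q p * qnum q p * (Q * q) - w * ((q - inverse q) * qnum q p) - w * w"
    unfolding up down divide_inverse Q_def by (simp add: algebra_simps)
  also have "\<dots> = qnum q p * qnum q p + u * ((q - inverse q) * qnum q p) - u * u"
    unfolding diff \<open>Q * q = 1\<close> by (simp add: algebra_simps)
  finally have "qnum q (p + 1) * qnum q (p - 1)
      = qnum q p * qnum q p + (q - inverse q) * u * qnum q p - u * u"
    by (simp add: mult_ac)
  then show "be p * de p = 1 + (q - inverse q) * ga p - ga p * ga p"
    using x unfolding 1 be_def de_def times_divide_times_eq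
    by (simp add: add_divide_distrib diff_divide_distrib)
  assume y: "qnum q (p + 1) \<noteq> 0"
  have "qnum q (p + 1) = inverse q * qnum q p + u"
    using up diff by (simp add: left_diff_distrib algebra_simps)
  then have "inverse q + ga p = qnum q (p + 1) / qnum q p"
    using x unfolding 1 by (simp add: field_simps)
  then show "ga (p + 1) * (inverse q + ga p) = q * ga p"
    using y unfolding ga_Suc 1 by simp
qed

lemma corner_coord_quadratic:
  assumes "q \<noteq> 0" "p \<ge> 1" "qnum q p \<noteq> 0"
  shows "corner_coord q p (corner_coord q p f) J = (q - inverse q) * corner_coord q p f J + f J"
proof -
  define al be ga de where "al = - (q powi (- int p) / qnum q p)"
    and "be = qnum q (p + 1) / qnum q p"
    and "ga = q powi int p / qnum q p"
    and "de = qnum q (p - 1) / qnum q p"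
  note 1 = corner_coeffs(1,2)[OF assms, folded al_def be_def ga_def de_def]
  have 2: "corner_coord q p f J = (if p \<notin> J \<and> p + 1 \<notin> J then q * f J
      else if p \<notin> J \<and> p + 1 \<in> J then al * f J + be * f (sswap p J)
      else if p \<in> J \<and> p + 1 \<notin> J then ga * f J + de * f (sswap p J)
      else - inverse q * f J)" for f J
    by (simp only: corner_coord_def al_def be_def ga_def de_def)
  define Q where "Q = inverse q"
  define f0 f1 where "f0 = f J" and "f1 = f (sswap p J)"
  have 3: "Q * q = 1"
    using assms by (simp add: Q_def)
  note 1 = 1[folded Q_def]
  consider "p \<in> J" "p + 1 \<in> J" | "p \<in> J" "p + 1 \<notin> J" | "p \<notin> J" "p + 1 \<in> J" | "p \<notin> J" "p + 1 \<notin> J"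
    by blast
  then have "corner_coord q p (corner_coord q p f) J = (q - Q) * corner_coord q p f J + f J" (is ?goal)
  proof cases
    assume "p \<in> J" "p + 1 \<in> J"
    then show ?goal
      using assms(1) by (simp add: 2 in_sswap_iff Q_def field_simps)
  next
    assume J: "p \<in> J" "p + 1 \<notin> J"
    show ?goal by (simp add: J J[simplified] 2[folded Q_def] in_sswap_iff flip: f0_def f1_def) (use 1 in Groebner_Basis.algebra)
  next
    assume J: "p \<notin> J" "p + 1 \<in> J"
    show ?goal by (simp add: J J[simplified] 2[folded Q_def] in_sswap_iff flip: f0_def f1_def) (use 1 in Groebner_Basis.algebra)
  next
    assume J: "p \<notin> J" "p + 1 \<notin> J"
    show ?goal by (simp add: J J[simplified] 2[folded Q_def] in_sswap_iff flip: f0_def f1_def) (use 3 in Groebner_Basis.algebra)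
  qed
  then show ?thesis
    by (simp add: Q_def)
qed

lemma corner_coord_commute:
  assumes "\<bar>int p - int r\<bar> > 1"
  shows "corner_coord q p (corner_coord q r f) J = corner_coord q r (corner_coord q p f) J"
proof -
  have d: "p \<noteq> r" "p \<noteq> r + 1" "r \<noteq> p + 1"
    using assms by auto
  have s: "sswap p (sswap r J) = sswap r (sswap p J)"
    using d by (auto simp: in_sswap_iff split: if_splits)
  define al be ga de where "al = (\<lambda>p. - (q powi (- int p) / qnum q p))"
    and "be = (\<lambda>p. qnum q (p + 1) / qnum q p)"
    and "ga = (\<lambda>p. q powi int p / qnum q p)"
    and "de = (\<lambda>p. qnum q (p - 1) / qnum q p)"
  have 1: "corner_coord q p f J = (if p \<notin> J \<and> p + 1 \<notin> J then q * f J
      else if p \<notin> J \<and> p + 1 \<in> J then al p * f J + be p * f (sswap p J)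
      else if p \<in> J \<and> p + 1 \<notin> J then ga p * f J + de p * f (sswap p J)
      else - inverse q * f J)" for p f J
    by (simp only: corner_coord_def al_def be_def ga_def de_def)
  show ?thesis
    using d by (simp add: 1 in_sswap_iff s algebra_simps)
qed

lemma corner_coord_braid:
  assumes "q \<noteq> 0" "p \<ge> 1" "qnum q p \<noteq> 0" "qnum q (p + 1) \<noteq> 0"
  shows "corner_coord q p (corner_coord q (p + 1) (corner_coord q p f)) J
    = corner_coord q (p + 1) (corner_coord q p (corner_coord q (p + 1) f)) J"
proof -
  define a1 b1 c1 d1 where "a1 = - (q powi (- int p) / qnum q p)"
    and "b1 = qnum q (p + 1) / qnum q p"
    and "c1 = q powi int p / qnum q p"
    and "d1 = qnum q (p - 1) / qnum q p"
  define a2 b2 c2 d2 where "a2 = - (q powi (- int (p + 1)) / qnum q (p + 1))"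
    and "b2 = qnum q (p + 1 + 1) / qnum q (p + 1)"
    and "c2 = q powi int (p + 1) / qnum q (p + 1)"
    and "d2 = qnum q (p + 1 - 1) / qnum q (p + 1)"
  define Q where "Q = inverse q"
  have "p + 1 \<ge> 1" "Q * q = 1"
    using assms by (simp_all add: Q_def)
  note rels = this(2)
    corner_coeffs(1,2)[OF assms(1-3), folded a1_def b1_def c1_def d1_def Q_def]
    corner_coeffs(1,2)[OF assms(1) this(1) assms(4), folded a2_def b2_def c2_def d2_def Q_def]
    corner_coeffs(3)[OF assms, folded c1_def c2_def Q_def]
  have E1: "corner_coord q p f J = (if p \<notin> J \<and> p + 1 \<notin> J then q * f J
      else if p \<notin> J \<and> p + 1 \<in> J then a1 * f J + b1 * f (sswap p J)
      else if p \<in> J \<and> p + 1 \<notin> J then c1 * f J + d1 * f (sswap p J)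
      else - Q * f J)" for f J
    by (simp only: corner_coord_def a1_def b1_def c1_def d1_def Q_def)
  have E2: "corner_coord q (p + 1) f J = (if p + 1 \<notin> J \<and> p + 2 \<notin> J then q * f J
      else if p + 1 \<notin> J \<and> p + 2 \<in> J then a2 * f J + b2 * f (sswap (p + 1) J)
      else if p + 1 \<in> J \<and> p + 2 \<notin> J then c2 * f J + d2 * f (sswap (p + 1) J)
      else - Q * f J)" for f J
    by (simp add: corner_coord_def a2_def b2_def c2_def d2_def Q_def)
  have m: "p + 2 \<in> sswap p J \<longleftrightarrow> p + 2 \<in> J" "p + 1 \<in> sswap p J \<longleftrightarrow> p \<in> J" "p \<in> sswap p J \<longleftrightarrow> p + 1 \<in> J"
    "p + 2 \<in> sswap (p + 1) J \<longleftrightarrow> p + 1 \<in> J" "p + 1 \<in> sswap (p + 1) J \<longleftrightarrow> p + 2 \<in> J"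
    "p \<in> sswap (p + 1) J \<longleftrightarrow> p \<in> J" for J
    by (auto simp: in_sswap_iff)
  define f0 f1 f2 f12 f21 where "f0 = f J" and "f1 = f (sswap p J)" and "f2 = f (sswap (p + 1) J)"
    and "f12 = f (sswap p (sswap (p + 1) J))" and "f21 = f (sswap (p + 1) (sswap p J))"
  note F = f0_def[symmetric] f1_def[symmetric] f2_def[symmetric] f12_def[symmetric] f21_def[symmetric]
  note E = E1 E2 m F sswap_sswap if_True if_False simp_thms
  show ?thesis
  proof (cases "p \<in> J"; cases "p + 1 \<in> J"; cases "p + 2 \<in> J")
    assume J: "p \<in> J" "p + 1 \<in> J" "p + 2 \<in> J"
    show ?thesis
      by (simp only: E J simp_thms)
  next
    assume J: "p \<in> J" "p + 1 \<in> J" "p + 2 \<notin> J"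
    show ?thesis
      by (simp only: E J simp_thms) (use rels in Groebner_Basis.algebra)
  next
    assume J: "p \<in> J" "p + 1 \<notin> J" "p + 2 \<in> J"
    show ?thesis
      by (simp only: E J simp_thms) (use rels in Groebner_Basis.algebra)
  next
    assume J: "p \<in> J" "p + 1 \<notin> J" "p + 2 \<notin> J"
    show ?thesis
      by (simp only: E J simp_thms) (use rels in Groebner_Basis.algebra)
  next
    assume J: "p \<notin> J" "p + 1 \<in> J" "p + 2 \<in> J"
    show ?thesis
      by (simp only: E J simp_thms) (use rels in Groebner_Basis.algebra)
  next
    assume J: "p \<notin> J" "p + 1 \<in> J" "p + 2 \<notin> J"
    show ?thesis
      by (simp only: E J simp_thms) (use rels in Groebner_Basis.algebra)
  next
    assume J: "p \<notin> J" "p + 1 \<notin> J" "p + 2 \<in> J"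
    show ?thesis
      by (simp only: E J simp_thms) (use rels in Groebner_Basis.algebra)
  next
    assume J: "p \<notin> J" "p + 1 \<notin> J" "p + 2 \<notin> J"
    show ?thesis
      by (simp only: E J simp_thms)
  qed
qed

lemma corner_space_lincomb:
  "f \<in> corner_space k l \<Longrightarrow> h \<in> corner_space k l \<Longrightarrow> (\<lambda>i. x * f i + y * h i) \<in> corner_space k l"
  by (simp add: corner_space_def)

lemma corner_op_relations:
  assumes adm: "corner_admissible k l q"
    and st: "(s, t) \<in> hecke_relations (k + l) q" and f: "f \<in> corner_space k l"
  shows "alg_eval (corner_op k l q) s f = alg_eval (corner_op k l q) t f"
proof -
  have nz: "q \<noteq> 0" "qnum q p \<noteq> 0" if "p \<in> {1..k + l}" for p
    using adm that by (auto simp: corner_admissible_def)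
  note coord = corner_op_coord[of _ k l] and closed = corner_op_closed[of _ k l]
  from st consider
      (braid) i where "1 \<le> i" "i + 1 \<le> k + l"
        "s = ATimes (ATimes (AGen i) (AGen (i + 1))) (AGen i)"
        "t = ATimes (ATimes (AGen (i + 1)) (AGen i)) (AGen (i + 1))"
    | (commute) i j where "i \<in> {1..k + l}" "j \<in> {1..k + l}" "\<bar>int i - int j\<bar> > 1"
        "s = ATimes (AGen i) (AGen j)" "t = ATimes (AGen j) (AGen i)"
    | (quadratic) i where "i \<in> {1..k + l}" "s = ATimes (AGen i) (AGen i)"
        "t = APlus (AScale (q - inverse q) (AGen i)) AOne"
    unfolding hecke_relations_def by blast
  then show ?thesis
  proof cases
    case braid
    then have i: "i \<in> {1..k + l}" "i + 1 \<in> {1..k + l}" by auto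
    show ?thesis
      unfolding braid(3,4) alg_eval.simps
      using corner_coord_braid[of q i f] nz[OF i(1)] nz[OF i(2)] i f closed[OF i(1)] closed[OF i(2)]
      by (simp add: coord fun_eq_iff)
  next
    case commute
    then show ?thesis
      using corner_coord_commute[of i j q f] f closed[OF commute(1)] closed[OF commute(2)]
      by (simp add: coord fun_eq_iff)
  next
    case quadratic
    then show ?thesis
      using corner_coord_quadratic[of q i f] f closed[OF quadratic(1)] nz[OF quadratic(1)]
      by (simp add: coord fun_eq_iff)
  qed
qed

lemma corner_rep_class:
  assumes "corner_admissible k l q" "t \<in> alg_terms {1..k + l}" "f \<in> corner_space k l"
  shows "corner_rep k l q (alg_class {1..k + l} (hecke_relations (k + l) q) t) f
    = alg_eval (corner_op k l q) t f"
proof -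
  let ?X = "alg_class {1..k + l} (hecke_relations (k + l) q) t"
  have "t \<in> ?X"
    using assms(2) by (simp add: alg_class_def alg_cong.refl)
  then have "(SOME t. t \<in> ?X) \<in> ?X"
    by (rule someI)
  then have "(t, SOME t. t \<in> ?X) \<in> alg_cong {1..k + l} (hecke_relations (k + l) q)"
    by (simp add: alg_class_def)
  then have "alg_eval (corner_op k l q) t f = alg_eval (corner_op k l q) (SOME t. t \<in> ?X) f"
    using assms(3)
    by (rule alg_eval_cong[where V = "corner_space k l", rotated -2])
      (simp_all add: corner_op_linear corner_op_closed corner_space_lincomb
        corner_op_relations[OF assms(1)], simp add: corner_space_def)
  then show ?thesis
    using assms(3) by (simp add: corner_rep_def)
qed

lemma corner_rep_algebra_hom:
  assumes adm: "corner_admissible k l q" and f: "f \<in> corner_space k l"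
    and X: "X \<in> carrier (hecke (k + l) q)" and Y: "Y \<in> carrier (hecke (k + l) q)"
  shows "corner_rep k l q X f \<in> corner_space k l"
    and "corner_rep k l q X (\<lambda>J. x * f J) = (\<lambda>J. x * corner_rep k l q X f J)"
    and "h \<in> corner_space k l \<Longrightarrow> corner_rep k l q X (\<lambda>J. f J + h J)
      = (\<lambda>J. corner_rep k l q X f J + corner_rep k l q X h J)"
    and "corner_rep k l q \<one>\<^bsub>hecke (k + l) q\<^esub> f = f"
    and "corner_rep k l q (X \<otimes>\<^bsub>hecke (k + l) q\<^esub> Y) f = corner_rep k l q X (corner_rep k l q Y f)"
    and "corner_rep k l q (X \<oplus>\<^bsub>hecke (k + l) q\<^esub> Y) f
      = (\<lambda>J. corner_rep k l q X f J + corner_rep k l q Y f J)"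
    and "corner_rep k l q (x \<odot>\<^bsub>hecke (k + l) q\<^esub> X) f = (\<lambda>J. x * corner_rep k l q X f J)"
proof -
  let ?G = "{1..k + l}" and ?V = "corner_space k l"
  let ?e = "alg_eval (corner_op k l q)"
  obtain s where s: "s \<in> alg_terms ?G" "X = alg_class ?G (hecke_relations (k + l) q) s"
    using X unfolding hecke_def by (rule presented_carrierE)
  obtain t where t: "t \<in> alg_terms ?G" "Y = alg_class ?G (hecke_relations (k + l) q) t"
    using Y unfolding hecke_def by (rule presented_carrierE)
  have closed: "?e u g \<in> ?V" if "u \<in> alg_terms ?G" "g \<in> ?V" for u g
    using that
  proof (induction u arbitrary: g)
    case (AGen p)
    then show ?case using corner_op_closed[of p k l g q] by simp
  qed (auto simp: corner_space_def)
  have lin: "?e u (\<lambda>i. a * g i + b * h i) = (\<lambda>i. a * ?e u g i + b * ?e u h i)" for u a b g h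
    by (rule alg_eval_linear) (rule corner_op_linear)
  have xf: "(\<lambda>J. x * f J) \<in> ?V"
    using f by (simp add: corner_space_def)
  note rep = corner_rep_class[OF adm]
  show "corner_rep k l q X f \<in> ?V"
    using s f by (simp add: rep closed del: One_nat_def)
  show "corner_rep k l q X (\<lambda>J. x * f J) = (\<lambda>J. x * corner_rep k l q X f J)"
    using s f xf lin[of s x f 0 f] by (simp add: rep del: One_nat_def)
  show "corner_rep k l q X (\<lambda>J. f J + h J) = (\<lambda>J. corner_rep k l q X f J + corner_rep k l q X h J)"
    if h: "h \<in> ?V"
    using s f h corner_space_lincomb[OF f h, of 1 1] lin[of s 1 f 1 h] by (simp add: rep del: One_nat_def)
  show "corner_rep k l q \<one>\<^bsub>hecke (k + l) q\<^esub> f = f"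
    using f by (simp add: hecke_def presented_zero_one rep del: One_nat_def)
  show "corner_rep k l q (X \<otimes>\<^bsub>hecke (k + l) q\<^esub> Y) f = corner_rep k l q X (corner_rep k l q Y f)"
    using s t f by (simp add: hecke_def presented_ops rep closed del: One_nat_def)
  show "corner_rep k l q (X \<oplus>\<^bsub>hecke (k + l) q\<^esub> Y) f
      = (\<lambda>J. corner_rep k l q X f J + corner_rep k l q Y f J)"
    using s t f by (simp add: hecke_def presented_ops rep closed del: One_nat_def)
  show "corner_rep k l q (x \<odot>\<^bsub>hecke (k + l) q\<^esub> X) f = (\<lambda>J. x * corner_rep k l q X f J)"
    using s f by (simp add: hecke_def presented_ops rep closed del: One_nat_def)
qed

lemma corner_rep_gen:
  assumes "corner_admissible k l q" "p \<in> {1..k + l}" "I \<in> corner_index k l"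
  shows "corner_rep k l q (hecke_gen (k + l) q p) (bvec I) = corner_act q p I"
proof -
  have I: "bvec I \<in> corner_space k l"
    using assms(3) by (auto simp: bvec_def corner_space_def)
  have "(\<Sum>I'\<in>corner_index k l. bvec I I' * corner_act q p I' J)
      = (\<Sum>I'\<in>corner_index k l. if I' = I then corner_act q p I J else 0)" for J
    by (rule sum.cong) (auto simp: bvec_def)
  then have "corner_op k l q p (bvec I) = corner_act q p I"
    using assms(3) finite_corner_index by (simp add: corner_op_def)
  then show ?thesis
    using assms I by (simp add: hecke_gen_def corner_rep_class del: One_nat_def)
qed

definition corner_hamiltonian :: "nat \<Rightarrow> nat \<Rightarrow> complex \<Rightarrow> (nat set \<Rightarrow> complex) \<Rightarrow> nat set \<Rightarrow> complex" where
  "corner_hamiltonian k l q = (\<lambda>f\<in>corner_space k l. \<lambda>J.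
     corner_rep k l q (\<Oplus>\<^bsub>hecke (k + l) q\<^esub>i\<in>{1..k + l}. hecke_gen (k + l) q i) f J
     - (q * of_nat k - inverse q * of_nat l) * f J)"

lemma corner_hamiltonian_apply:
  assumes adm: "corner_admissible k l q" and f: "f \<in> corner_space k l"
  shows "corner_hamiltonian k l q f
    = (\<lambda>J. (\<Sum>p=1..k + l. corner_op k l q p f J) - (q * of_nat k - inverse q * of_nat l) * f J)"
proof -
  let ?H = "hecke (k + l) q"
  interpret H: ring ?H
    unfolding hecke_def by (rule presented_algebra_ring)
  have gen: "hecke_gen (k + l) q p \<in> carrier ?H" if "p \<in> {1..k + l}" for p
    unfolding hecke_def hecke_gen_def by (rule alg_class_carrier) (use that in simp)
  have op: "corner_rep k l q (hecke_gen (k + l) q p) f = corner_op k l q p f" if "p \<in> {1..k + l}" for p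
    using that f adm by (simp add: hecke_gen_def corner_rep_class del: One_nat_def)
  have "corner_rep k l q (\<Oplus>\<^bsub>?H\<^esub>i\<in>A. hecke_gen (k + l) q i) f = (\<lambda>J. \<Sum>p\<in>A. corner_op k l q p f J)"
    if "finite A" "A \<subseteq> {1..k + l}" for A
    using that
  proof (induction A)
    case empty
    have "corner_rep k l q \<zero>\<^bsub>?H\<^esub> f = (\<lambda>J. 0)"
      using f adm by (simp add: hecke_def presented_zero_one corner_rep_class del: One_nat_def)
    then show ?case by simp
  next
    case (insert a A)
    have A: "hecke_gen (k + l) q \<in> A \<rightarrow> carrier ?H" "hecke_gen (k + l) q a \<in> carrier ?H"
      using insert.prems gen by auto
    have "a \<in> {1..k + l}"
      using insert.prems by simp
    then show ?case
      using insert A H.finsum_closed[OF A(1)]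
      by (simp add: corner_rep_algebra_hom(6)[OF adm f] op del: One_nat_def)
  qed
  then show ?thesis
    using f by (simp add: corner_hamiltonian_def del: One_nat_def)
qed

text \<open>On the finite-dimensional \<open>corner_space k l\<close> the spectrum is the set of eigenvalues.\<close>

definition op_spectrum :: "('i \<Rightarrow> complex) set \<Rightarrow> (('i \<Rightarrow> complex) \<Rightarrow> 'i \<Rightarrow> complex) \<Rightarrow> complex set" where
  "op_spectrum V T = {z. \<exists>f\<in>V. f \<noteq> (\<lambda>i. 0) \<and> T f = (\<lambda>i. z * f i)}"

end

theory Submission
  imports Defs "HOL-Library.Function_Algebras" "HOL-Library.Infinite_Set"
begin

text \<open>The Hamiltonian describes free fermions. Writing \<open>[p]\<close> for \<open>(p)\<^sub>q\<close>, \<open>N = k + l\<close> and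
  \<open>r\<^sub>p = [p + 1] / [p]\<close>, its diagonal part is additive over the elements of \<open>I\<close>, and its off-diagonal
  part moves one element to a neighbouring free place. So it is the second quantization of a
  tridiagonal one-particle operator on the sites \<open>2, \<dots>, N + 1\<close>, that is, it satisfies the Leibniz
  rule with respect to the fermionic creation operators. The one-particle operator is conjugate to
  the adjacency operator of a path with \<open>N\<close> vertices: its eigenvectors are the partial sums
  \<open>\<Sum>z<x. [z] sin (\<pi> m z / (N + 1))\<close>, with eigenvalue \<open>2 cos (\<pi> m / (N + 1))\<close>. They form
  a basis as \<open>[1], \<dots>, [N]\<close> are nonzero. Hence the products of \<open>l\<close> distinct creation operators
  applied to the vacuum span the space; by a dimension count none of them vanishes, and they are
  eigenvectors for the sums of \<open>l\<close> distinct one-particle eigenvalues.\<close>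

section \<open>Fermionic creation operators\<close>

text \<open>Jordan-Wigner sign: the parity of the move of \<open>x\<close> from the front to its
  place in the increasing order of \<open>J\<close>.\<close>

definition jw_sign :: "nat \<Rightarrow> nat set \<Rightarrow> complex" where
  "jw_sign x J = (- 1) ^ card {y \<in> J. y < x}"

text \<open>Exterior multiplication by \<open>\<phi>\<close>, where \<open>bvec J\<close> stands for
  the wedge product of the sites of \<open>J\<close> in increasing order.\<close>

definition create :: "(nat \<Rightarrow> complex) \<Rightarrow> (nat set \<Rightarrow> complex) \<Rightarrow> nat set \<Rightarrow> complex" where
  "create \<phi> F J = (\<Sum>x\<in>J. jw_sign x J * \<phi> x * F (J - {x}))"

lemma jw_sign_insert:
  assumes "finite K" "x \<notin> K"
  shows "jw_sign y (insert x K) = (if x < y then - jw_sign y K else jw_sign y K)"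
proof -
  have "{z \<in> insert x K. z < y} = (if x < y then insert x {z \<in> K. z < y} else {z \<in> K. z < y})"
    by auto
  then show ?thesis
    using assms by (simp add: jw_sign_def)
qed

lemma jw_sign_remove:
  assumes "finite J" "x \<in> J"
  shows "jw_sign y (J - {x}) = (if x < y then - jw_sign y J else jw_sign y J)"
  using jw_sign_insert[of "J - {x}" x y] assms by (simp add: insert_absorb)

lemma jw_sign_Suc: "p \<notin> K \<Longrightarrow> jw_sign (Suc p) K = jw_sign p K"
  unfolding jw_sign_def by (metis less_Suc_eq)

lemma create_infinite: "infinite J \<Longrightarrow> create \<phi> F J = 0"
  by (simp add: create_def)

lemma create_insert:
  assumes "finite K" "x \<notin> K"
  shows "create \<phi> F (insert x K) = jw_sign x K * \<phi> x * F K
    + (\<Sum>y\<in>K. (if x < y then - jw_sign y K else jw_sign y K) * \<phi> y * F (insert x (K - {y})))"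
proof -
  have "insert x K - {y} = insert x (K - {y})" if "y \<in> K" for y
    using that assms by auto
  then show ?thesis
    using assms by (auto simp: create_def jw_sign_insert intro!: sum.cong)
qed

text \<open>Removing two sites in either order leaves the same set, but the sign of the larger one
  flips when the smaller one is removed first.\<close>

lemma create_anticommute: "create \<phi> (create \<psi> F) J = - create \<psi> (create \<phi> F) J"
proof (cases "finite J")
  case True
  \<comment> \<open>The diagonal is padded with zeros, so that both sums run over \<open>J\<close>
    and can be swapped.\<close>
  have double: "create \<phi> (create \<psi> F) J = (\<Sum>x\<in>J. \<Sum>y\<in>J. if x = y then 0 else
      (if x < y then - 1 else 1) * jw_sign x J * jw_sign y J * \<phi> x * \<psi> y * F (J - {x, y}))"
    for \<phi> \<psi>
  proof -
    have "create \<psi> F (J - {x}) = (\<Sum>y\<in>J. if x = y then 0 else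
        (if x < y then - 1 else 1) * jw_sign y J * \<psi> y * F (J - {x, y}))" if "x \<in> J" for x
    proof -
      have "(\<Sum>y\<in>J. if x = y then 0 else
          (if x < y then - 1 else 1) * jw_sign y J * \<psi> y * F (J - {x, y}))
        = (\<Sum>y\<in>J - {x}. if x = y then 0 else
          (if x < y then - 1 else 1) * jw_sign y J * \<psi> y * F (J - {x, y}))"
        using True by (intro sum.mono_neutral_right) auto
      also have "\<dots> = create \<psi> F (J - {x})"
        unfolding create_def using True that
        by (auto simp: jw_sign_remove Diff_insert2[symmetric] intro!: sum.cong split: if_splits)
      finally show ?thesis ..
    qed
    then show ?thesis
      unfolding create_def[of \<phi>] by (auto simp: sum_distrib_left intro!: sum.cong)
  qed
  have "create \<phi> (create \<psi> F) J = (\<Sum>y\<in>J. \<Sum>x\<in>J. if x = y then 0 else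
      (if x < y then - 1 else 1) * jw_sign x J * jw_sign y J * \<phi> x * \<psi> y * F (J - {x, y}))"
    unfolding double by (rule sum.swap)
  also have "\<dots> = - create \<psi> (create \<phi> F) J"
    unfolding double sum_negf[symmetric] by (auto simp: insert_commute intro!: sum.cong)
  finally show ?thesis .
qed (simp add: create_infinite)

text \<open>Pauli exclusion: by anticommutation each value equals its own negative.\<close>

lemma create_create: "create \<phi> (create \<phi> F) = (\<lambda>J. 0)"
  using create_anticommute[of \<phi> \<phi> F] by (simp add: fun_eq_iff)

section \<open>Operators on two neighbouring sites and their Leibniz rule\<close>

definition bond ::
    "nat \<Rightarrow> complex \<Rightarrow> complex \<Rightarrow> complex \<Rightarrow> complex \<Rightarrow> (nat set \<Rightarrow> complex) \<Rightarrow> nat set \<Rightarrow> complex" where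
  "bond p e g a b F J =
    (if p \<in> J then if p + 1 \<in> J then (e + g) * F J else e * F J + a * F (sswap p J)
     else if p + 1 \<in> J then g * F J + b * F (sswap p J) else 0)"

text \<open>The matrix with rows (e, a) and (b, g) on the sites \<open>p\<close> and
  \<open>p + 1\<close>. \<open>bond\<close> is its extension to many particles; on a doubly occupied
  pair it acts by the trace.\<close>

definition bond1 ::
    "nat \<Rightarrow> complex \<Rightarrow> complex \<Rightarrow> complex \<Rightarrow> complex \<Rightarrow> (nat \<Rightarrow> complex) \<Rightarrow> nat \<Rightarrow> complex" where
  "bond1 p e g a b \<phi> x =
    (if x = p then e * \<phi> p + a * \<phi> (p + 1) else if x = p + 1 then g * \<phi> (p + 1) + b * \<phi> p else 0)"

text \<open>Only the occupation of \<open>p\<close> and \<open>p + 1\<close> matters. No other site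
  lies between them, so \<open>p\<close> and \<open>p + 1\<close> affect the signs of the other
  sites in the same way. Splitting off these sites as \<open>K\<close> leaves four cases.\<close>

lemma bond_create:
  "bond p e g a b (create \<phi> F) J = create \<phi> (bond p e g a b F) J + create (bond1 p e g a b \<phi>) F J"
proof (cases "finite J")
  case False
  moreover have "infinite (sswap p J)"
    using False by (simp add: sswap_def finite_image_iff)
  ultimately show ?thesis
    by (simp add: create_infinite bond_def)
next
  case True
  define K where "K = J - {p, p + 1}"
  have K: "finite K" "p \<notin> K" "p + 1 \<notin> K" "Suc p \<notin> K"
    using True by (auto simp: K_def)
  have swap: "sswap p (insert p L) = insert (p + 1) L" "sswap p (insert (p + 1) L) = insert p L"
    if "p \<notin> L" "p + 1 \<notin> L" for L
    using that by (auto simp: in_sswap_iff split: if_splits)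
  have neq: "x \<noteq> p" "x \<noteq> p + 1" if "x \<in> K" for x
    using that K by auto
  have lt: "p + 1 < x \<longleftrightarrow> p < x" "Suc p < x \<longleftrightarrow> p < x" if "x \<in> K" for x
    using neq[OF that] by auto
  have b1: "bond1 p e g a b \<phi> x = 0" if "x \<in> K" for x
    using neq[OF that] by (simp add: bond1_def)
  have b: "bond p e g a b F L = 0"
    "bond p e g a b F (insert p L) = e * F (insert p L) + a * F (insert (p + 1) L)"
    "bond p e g a b F (insert (p + 1) L) = g * F (insert (p + 1) L) + b * F (insert p L)"
    "bond p e g a b F (insert p (insert (p + 1) L)) = (e + g) * F (insert p (insert (p + 1) L))"
    if "p \<notin> L" "p + 1 \<notin> L" for L F
    using that by (auto simp: bond_def swap swap[simplified])
  \<comment> \<open>The sign changes that \<open>p\<close> and \<open>p + 1\<close> cause at a site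
    of \<open>K\<close> cancel each other.\<close>
  have cr: "create \<psi> G (insert p (insert (p + 1) K)) =
      jw_sign p K * (\<psi> p * G (insert (p + 1) K) - \<psi> (p + 1) * G (insert p K))
      + (\<Sum>y\<in>K. jw_sign y K * \<psi> y * G (insert p (insert (p + 1) (K - {y}))))" for \<psi> G
  proof -
    have "insert (p + 1) K - {y} = insert (p + 1) (K - {y})" if "y \<in> K" for y
      using neq[OF that] by auto
    moreover have "insert (p + 1) K - {p + 1} = K"
      using K by auto
    moreover have "jw_sign (p + 1) (insert (p + 1) K) = jw_sign p K"
      using K by (simp add: jw_sign_insert jw_sign_Suc)
    ultimately show ?thesis
      using K lt by (subst create_insert)
        (auto simp: jw_sign_insert algebra_simps intro!: sum.cong)
  qed
  define \<tau> where "\<tau> y = (if p < y then - jw_sign y K else jw_sign y K)" for y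
  have cr1: "create \<psi> G (insert p K) = jw_sign p K * \<psi> p * G K
      + (\<Sum>y\<in>K. \<tau> y * \<psi> y * G (insert p (K - {y})))"
    and cr2: "create \<psi> G (insert (p + 1) K) = jw_sign p K * \<psi> (p + 1) * G K
      + (\<Sum>y\<in>K. \<tau> y * \<psi> y * G (insert (p + 1) (K - {y})))"
    for \<psi> G
    using K lt by (auto simp: create_insert jw_sign_Suc \<tau>_def intro!: sum.cong)
  have m: "p \<notin> K - {y}" "p + 1 \<notin> K - {y}" for y
    using K by auto
  have one: "bond1 p e g a b \<phi> p = e * \<phi> p + a * \<phi> (p + 1)"
    "bond1 p e g a b \<phi> (p + 1) = g * \<phi> (p + 1) + b * \<phi> p"
    by (simp_all add: bond1_def)
  note simps = cr cr1 cr2 b[OF K(2,3)] b[OF m] one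
  consider "J = K" | "J = insert p K" | "J = insert (p + 1) K" | "J = insert p (insert (p + 1) K)"
    unfolding K_def by blast
  then show ?thesis
  proof cases
    case 1
    have "create \<phi> (bond p e g a b F) K = 0" "create (bond1 p e g a b \<phi>) F K = 0"
      unfolding create_def using b[OF m] b1 by auto
    then show ?thesis
      using 1 b[OF K(2,3)] by simp
  next
    case 2
    show ?thesis
      unfolding 2 simps by (simp add: b1 algebra_simps sum.distrib sum_distrib_left)
  next
    case 3
    show ?thesis
      unfolding 3 simps by (simp add: b1 algebra_simps sum.distrib sum_distrib_left)
  next
    \<comment> \<open>On the doubly occupied pair the hopping terms cancel and the diagonal ones add
      up to the trace \<open>e + g\<close>.\<close>
    case 4
    show ?thesis
      unfolding 4 simps by (simp add: b1 algebra_simps sum.distrib sum_distrib_left)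
  qed
qed


section \<open>Products of creation operators\<close>

lemma create_lincomb:
  "create \<phi> (\<lambda>J. x * F J + y * G J) = (\<lambda>J. x * create \<phi> F J + y * create \<phi> G J)"
  by (rule ext) (simp add: create_def sum.distrib sum_distrib_left algebra_simps)

lemma create_scale: "create \<phi> (\<lambda>J. x * F J) = (\<lambda>J. x * create \<phi> F J)"
  using create_lincomb[of \<phi> x F 0] by simp

lemma create_zero [simp]: "create \<phi> (\<lambda>J. 0) = (\<lambda>J. 0)"
  by (simp add: create_def fun_eq_iff)

lemma create_sum: "create \<phi> (\<lambda>J. \<Sum>p\<in>A. F p J) J = (\<Sum>p\<in>A. create \<phi> (F p) J)"
  unfolding create_def by (subst sum.swap) (simp add: sum_distrib_left)

lemma create_sum_left: "create (\<lambda>x. \<Sum>p\<in>A. \<phi> p x) F J = (\<Sum>p\<in>A. create (\<phi> p) F J)"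
  unfolding create_def by (subst sum.swap) (simp add: sum_distrib_left sum_distrib_right)

lemma create_add: "create \<phi> (\<lambda>J. F J + G J) J = create \<phi> F J + create \<phi> G J"
  by (simp add: create_def sum.distrib ring_distribs)

lemma create_add_left: "create (\<lambda>x. \<phi> x + \<psi> x) F J = create \<phi> F J + create \<psi> F J"
  by (simp add: create_def sum.distrib ring_distribs)

text \<open>The new site is the smallest, so it passes no occupied site and picks up the sign
  1.\<close>

lemma create_bvec:
  assumes "finite K" "\<And>y. y \<in> K \<Longrightarrow> x < y"
  shows "create (\<lambda>y. if y = x then 1 else 0) (bvec K) = bvec (insert x K)"
proof
  fix J
  have K: "x \<notin> K" using assms(2) by blast
  have "create (\<lambda>y. if y = x then 1 else 0) (bvec K) J
      = (\<Sum>y\<in>J. if y = x then jw_sign x J * bvec K (J - {x}) else 0)"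
    unfolding create_def by (intro sum.cong) auto
  also have "\<dots> = bvec (insert x K) J"
  proof (cases "finite J \<and> x \<in> J")
    case True
    have "J - {x} = K \<longleftrightarrow> J = insert x K"
      using True K by auto
    moreover have "jw_sign x (insert x K) = 1"
    proof -
      have "{y \<in> insert x K. y < x} = {}"
        using assms(2) by force
      then show ?thesis by (simp only: jw_sign_def) simp
    qed
    ultimately show ?thesis
      using True by (auto simp: bvec_def)
  next
    case False
    then have "J \<noteq> insert x K"
      using assms(1) by blast
    with False show ?thesis
      by (cases "finite J") (simp_all add: bvec_def)
  qed
  finally show "create (\<lambda>y. if y = x then 1 else 0) (bvec K) J = bvec (insert x K) J" .
qed

text \<open>The wedge product of the functions \<open>\<phi> m\<close>; its value at a set of
  \<open>length ms\<close> sites is a Slater determinant.\<close>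

definition slater :: "(nat \<Rightarrow> nat \<Rightarrow> complex) \<Rightarrow> nat list \<Rightarrow> nat set \<Rightarrow> complex" where
  "slater \<phi> ms = foldr (\<lambda>m. create (\<phi> m)) ms (bvec {})"

lemma slater_simps [simp]:
  "slater \<phi> [] = bvec {}" "slater \<phi> (m # ms) = create (\<phi> m) (slater \<phi> ms)"
  by (simp_all add: slater_def)

text \<open>Each factor uses up one site of \<open>J\<close>, and this site has to lie in the common
  support \<open>S\<close>.\<close>

lemma slater_supp:
  assumes "\<And>m x. m \<in> set ms \<Longrightarrow> x \<notin> S \<Longrightarrow> \<phi> m x = 0" "slater \<phi> ms J \<noteq> 0"
  shows "J \<subseteq> S \<and> card J = length ms \<and> finite J"
  using assms
proof (induction ms arbitrary: J)
  case Nil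
  then show ?case by (auto simp: bvec_def split: if_splits)
next
  case (Cons m ms)
  have "\<exists>x\<in>J. jw_sign x J * \<phi> m x * slater \<phi> ms (J - {x}) \<noteq> 0"
    using Cons.prems(2) unfolding slater_simps create_def by (meson sum.not_neutral_contains_not_neutral)
  then obtain x where x: "x \<in> J" "\<phi> m x \<noteq> 0" "slater \<phi> ms (J - {x}) \<noteq> 0"
    by auto
  have "J - {x} \<subseteq> S \<and> card (J - {x}) = length ms \<and> finite (J - {x})"
    by (rule Cons.IH) (use Cons.prems x in auto)
  moreover from this have fin: "finite J"
    by simp
  moreover have "x \<in> S"
    using x Cons.prems(1)[of m x] by auto
  moreover have "card J = Suc (card (J - {x}))"
    using fin x(1) by (rule card.remove)
  ultimately show ?case
    by auto
qed

text \<open>Anticommutation moves the repeated factor next to its twin, where the product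
  vanishes.\<close>

lemma create_slater_mem: "m \<in> set ms \<Longrightarrow> create (\<phi> m) (slater \<phi> ms) = (\<lambda>J. 0)"
proof (induction ms)
  case (Cons a ms)
  have "create (\<phi> m) (slater \<phi> (a # ms)) = (\<lambda>J. - create (\<phi> a) (create (\<phi> m) (slater \<phi> ms)) J)"
    unfolding slater_simps by (rule ext) (rule create_anticommute)
  then show ?case
    using Cons by (cases "m = a") (auto simp: create_create)
qed simp

text \<open>The new factor is moved to its sorted place by anticommutation, each exchange costing a
  factor -1, which \<open>c\<close> collects.\<close>

lemma create_slater_insort:
  "\<exists>c. create (\<phi> m) (slater \<phi> ms) = (\<lambda>J. c * slater \<phi> (insort m ms) J)"
proof (induction ms)
  case Nil
  show ?case by (rule exI[of _ 1]) simp
next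
  case (Cons a ms)
  show ?case
  proof (cases "m \<le> a")
    case True
    then show ?thesis by (intro exI[of _ 1]) simp
  next
    case False
    obtain c where c: "create (\<phi> m) (slater \<phi> ms) = (\<lambda>J. c * slater \<phi> (insort m ms) J)"
      using Cons.IH by blast
    have "create (\<phi> m) (slater \<phi> (a # ms)) = (\<lambda>J. - create (\<phi> a) (create (\<phi> m) (slater \<phi> ms)) J)"
      unfolding slater_simps by (rule ext) (rule create_anticommute)
    also have "\<dots> = (\<lambda>J. - c * slater \<phi> (insort m (a # ms)) J)"
      using False by (simp add: c create_scale)
    finally show ?thesis by blast
  qed
qed

text \<open>By the Leibniz rule \<open>H\<close> acts on one factor at a time, so the one-particle
  eigenvalues add up.\<close>

lemma slater_eigen:
  assumes deriv: "\<And>\<phi> F. H (create \<phi> F) = (\<lambda>J. create \<phi> (H F) J + create (h \<phi>) F J)"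
    and vac: "H (bvec {}) = (\<lambda>J. 0)"
    and eig: "\<And>m. m \<in> set ms \<Longrightarrow> h (\<phi> m) = (\<lambda>x. ev m * \<phi> m x)"
  shows "H (slater \<phi> ms) = (\<lambda>J. sum_list (map ev ms) * slater \<phi> ms J)"
  using eig
proof (induction ms)
  case (Cons m ms)
  have "H (slater \<phi> (m # ms)) J = sum_list (map ev (m # ms)) * slater \<phi> (m # ms) J" for J
  proof -
    have "create (\<lambda>x. ev m * \<phi> m x) F J = ev m * create (\<phi> m) F J" for F
      by (simp add: create_def sum_distrib_left mult_ac)
    moreover have "H (slater \<phi> ms) = (\<lambda>J. sum_list (map ev ms) * slater \<phi> ms J)"
      using Cons by simp
    ultimately show ?thesis
      using Cons.prems[of m] by (simp add: deriv create_scale ring_distribs)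
  qed
  then show ?case
    by blast
qed (simp add: vac)

section \<open>Spans, dimension count and eigenvalues for functions on sets\<close>

interpretation fun_space: vector_space "\<lambda>c (f :: nat set \<Rightarrow> complex) J. c * f J"
  by unfold_locales (simp_all add: fun_eq_iff algebra_simps)

lemma create_span:
  assumes "F \<in> fun_space.span A" "\<And>G. G \<in> A \<Longrightarrow> create \<phi> G \<in> fun_space.span B"
  shows "create \<phi> F \<in> fun_space.span B"
  using assms(1)
proof (induction rule: fun_space.span_induct_alt)
  case base
  have "create \<phi> 0 = (0 :: nat set \<Rightarrow> complex)"
    by (simp add: create_def fun_eq_iff)
  then show ?case
    by (simp only: fun_space.span_zero)
next
  case (step c G F)
  have "create \<phi> ((\<lambda>J. c * G J) + F) = (\<lambda>J. c * create \<phi> G J) + create \<phi> F"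
    using create_lincomb[of \<phi> c G 1 F] by (simp add: plus_fun_def)
  also have "\<dots> \<in> fun_space.span B"
    by (rule fun_space.span_add[OF fun_space.span_scale[OF assms(2)[OF step(1)]] step(2)])
  finally show ?case .
qed

text \<open>Sorting fixes one order of the factors for each set; any other order gives the same
  product up to a sign.\<close>

definition slater_sets :: "(nat \<Rightarrow> nat \<Rightarrow> complex) \<Rightarrow> nat set \<Rightarrow> nat \<Rightarrow> (nat set \<Rightarrow> complex) set" where
  "slater_sets \<phi> B l = (\<lambda>M. slater \<phi> (sorted_list_of_set M)) ` {M. M \<subseteq> B \<and> card M = l}"

text \<open>Either \<open>m\<close> occurs in the product already, which then becomes 0, or sorting
  it in gives a multiple of the product for \<open>insert m M\<close>.\<close>

lemma create_slater_sets:
  assumes "finite B" "m \<in> B" "G \<in> slater_sets \<phi> B l"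
  shows "create (\<phi> m) G \<in> fun_space.span (slater_sets \<phi> B (Suc l))"
proof -
  obtain M where M: "M \<subseteq> B" "card M = l" "G = slater \<phi> (sorted_list_of_set M)"
    using assms(3) unfolding slater_sets_def by blast
  have fin: "finite M"
    using M(1) assms(1) by (rule finite_subset)
  show ?thesis
  proof (cases "m \<in> M")
    case True
    then have "create (\<phi> m) G = 0"
      using create_slater_mem[of m "sorted_list_of_set M" \<phi>] fin M(3) by (simp add: zero_fun_def)
    then show ?thesis
      by (simp add: fun_space.span_zero)
  next
    case False
    obtain c where c: "create (\<phi> m) G = (\<lambda>J. c * slater \<phi> (insort m (sorted_list_of_set M)) J)"
      using create_slater_insort M(3) by blast
    have "slater \<phi> (insort m (sorted_list_of_set M)) \<in> slater_sets \<phi> B (Suc l)"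
      unfolding slater_sets_def using False fin M assms
      by (intro image_eqI[of _ _ "insert m M"]) auto
    then show ?thesis
      unfolding c by (rule fun_space.span_scale[OF fun_space.span_base])
  qed
qed

lemma sum_fun_apply: "(\<Sum>a\<in>A. F a) x = (\<Sum>a\<in>A. F a x)"
  for F :: "'a \<Rightarrow> 'b \<Rightarrow> 'c :: comm_monoid_add"
  by (induction A rule: infinite_finite_induct) simp_all

text \<open>Induction on the number of particles: the smallest site of \<open>J\<close> is split off
  as a creation operator, and its indicator function is expanded in the functions
  \<open>\<phi> m\<close>.\<close>

lemma bvec_in_span:
  assumes B: "finite B" and S: "finite S"
    and basis: "\<And>x. x \<in> S \<Longrightarrow> \<exists>c. (\<lambda>y. if y = x then 1 else 0) = (\<lambda>y. \<Sum>m\<in>B. c m * \<phi> m y)"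
    and J: "J \<subseteq> S" "card J = l"
  shows "bvec J \<in> fun_space.span (slater_sets \<phi> B l)"
  using J
proof (induction l arbitrary: J)
  case 0
  then have "J = {}"
    using finite_subset[OF 0(1) S] by simp
  then have "bvec J \<in> slater_sets \<phi> B 0"
    by (auto simp: slater_sets_def intro!: image_eqI[of _ _ "{}"])
  then show ?case
    by (rule fun_space.span_base)
next
  case (Suc l)
  have fin: "finite J" "J \<noteq> {}"
    using finite_subset[OF Suc.prems(1) S] Suc.prems(2) by auto
  define x K where "x = Min J" and "K = J - {x}"
  have x: "x \<in> J" "J = insert x K" "x \<notin> K"
    using Min_in[OF fin] by (auto simp: x_def K_def)
  have lt: "x < y" if "y \<in> K" for y
  proof -
    have "y \<in> J" "y \<noteq> x"
      using that by (simp_all add: K_def)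
    moreover have "x \<le> y"
      unfolding x_def using fin(1) \<open>y \<in> J\<close> by (rule Min_le)
    ultimately show ?thesis
      by simp
  qed
  have "finite K"
    using fin by (simp add: K_def)
  then have bJ: "bvec J = create (\<lambda>y. if y = x then 1 else 0) (bvec K)"
    unfolding x(2) by (rule create_bvec[symmetric]) (rule lt)
  have K: "bvec K \<in> fun_space.span (slater_sets \<phi> B l)"
    by (rule Suc.IH) (use Suc.prems x(1) fin in \<open>auto simp: K_def\<close>)
  obtain c where c: "(\<lambda>y. if y = x then 1 else 0) = (\<lambda>y. \<Sum>m\<in>B. c m * \<phi> m y)"
    using basis x Suc.prems by blast
  have "create (\<lambda>y. \<Sum>m\<in>B. c m * \<phi> m y) (bvec K)
      = (\<lambda>I. \<Sum>m\<in>B. c m * create (\<phi> m) (bvec K) I)"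
    unfolding create_def sum_distrib_left sum_distrib_right
    by (rule ext, subst sum.swap) (simp add: mult_ac)
  also have "\<dots> = (\<Sum>m\<in>B. (\<lambda>I. c m * create (\<phi> m) (bvec K) I))"
    by (simp add: fun_eq_iff sum_fun_apply)
  also have "\<dots> \<in> fun_space.span (slater_sets \<phi> B (Suc l))"
    by (intro fun_space.span_sum fun_space.span_scale create_span[OF K] create_slater_sets B)
  finally show ?case
    unfolding bJ c .
qed

lemma independent_bvec: "finite A \<Longrightarrow> fun_space.independent (bvec ` A)"
proof (rule fun_space.independent_if_scalars_zero)
  fix c :: "(nat set \<Rightarrow> complex) \<Rightarrow> complex" and v
  assume A: "finite A" and 0: "(\<Sum>x\<in>bvec ` A. (\<lambda>J. c x * x J)) = 0" and "v \<in> bvec ` A"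
  then obtain I where I: "I \<in> A" "v = bvec I" by blast
  have "inj_on bvec A"
    by (rule inj_onI) (metis bvec_def zero_neq_one)
  then have "(\<Sum>K\<in>A. c (bvec K) * bvec K I) = 0"
    using fun_cong[OF 0, of I] by (simp add: sum_fun_apply sum.reindex)
  moreover have "(\<Sum>K\<in>A. c (bvec K) * bvec K I) = (\<Sum>K\<in>A. if K = I then c v else 0)"
    using I by (intro sum.cong) (auto simp: bvec_def)
  ultimately show "c v = 0"
    using A I by simp
qed simp

text \<open>Dimension count: were one product 0, fewer products than there are basis vectors
  \<open>bvec J\<close> would span all of these, although they are independent.\<close>

lemma slater_nonzero:
  assumes B: "finite B" and S: "finite S" "card S = card B"
    and basis: "\<And>x. x \<in> S \<Longrightarrow> \<exists>c. (\<lambda>y. if y = x then 1 else 0) = (\<lambda>y. \<Sum>m\<in>B. c m * \<phi> m y)"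
    and M: "M \<subseteq> B"
  shows "slater \<phi> (sorted_list_of_set M) \<noteq> (\<lambda>J. 0)"
proof
  assume 0: "slater \<phi> (sorted_list_of_set M) = (\<lambda>J. 0)"
  let ?l = "card M" and ?f = "\<lambda>M. slater \<phi> (sorted_list_of_set M)"
  let ?M = "{N. N \<subseteq> B \<and> card N = ?l}"
  let ?S = "{J. J \<subseteq> S \<and> card J = ?l}"
  have fin: "finite ?M" "finite ?S"
    using B S by auto
  have "slater_sets \<phi> B ?l \<subseteq> insert 0 (?f ` (?M - {M}))"
    using 0 by (auto simp: slater_sets_def zero_fun_def)
  then have "fun_space.span (slater_sets \<phi> B ?l) \<subseteq> fun_space.span (?f ` (?M - {M}))"
    unfolding fun_space.span_insert_0[symmetric, of "?f ` (?M - {M})"] by (rule fun_space.span_mono)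
  then have "bvec ` ?S \<subseteq> fun_space.span (?f ` (?M - {M}))"
    using bvec_in_span[OF B S(1) basis] by blast
  then have "card (bvec ` ?S) \<le> card (?f ` (?M - {M}))"
    using fun_space.independent_span_bound[of "?f ` (?M - {M})" "bvec ` ?S"] independent_bvec fin
    by blast
  moreover have "card (bvec ` ?S) = card ?S"
    by (intro card_image inj_onI) (metis bvec_def zero_neq_one)
  moreover have "card (?f ` (?M - {M})) \<le> card (?M - {M})"
    using fin by (intro card_image_le) auto
  moreover have "card (?M - {M}) < card ?M"
    using fin M by (intro psubset_card_mono) auto
  \<comment> \<open>Both are the same binomial coefficient, as \<open>S\<close> and \<open>B\<close>
    have equally many elements.\<close>
  moreover have "card ?M = card ?S"
    using B S by (simp add: n_subsets)
  ultimately show False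
    by linarith
qed

text \<open>The eigenvectors are peeled off one by one: if \<open>z\<close> differs from the
  eigenvalue of \<open>v\<close>, then \<open>f\<close> already lies in the span of the remaining
  ones. In the end \<open>f\<close> is 0.\<close>

lemma eigenvalue_of_span:
  assumes "finite E"
    and lin: "\<And>x y f g. H (\<lambda>J. x * f J + y * g J) = (\<lambda>J. x * H f J + y * H g J)"
    and eig: "\<And>v. v \<in> E \<Longrightarrow> \<exists>c\<in>C. H v = (\<lambda>J. c * v J)"
    and f: "f \<in> fun_space.span E" "H f = (\<lambda>J. z * f J)" "f \<noteq> (\<lambda>J. 0)"
  shows "z \<in> C"
proof (rule ccontr)
  assume z: "z \<notin> C"
  have "f = 0"
    using assms(1) eig f(1)
  proof (induction E)
    case (insert v E)
    obtain c where c: "c \<in> C" "H v = (\<lambda>J. c * v J)"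
      by (rule bexE[OF insert.prems(1)[OF insertI1]])
    obtain k where k: "f - (\<lambda>J. k * v J) \<in> fun_space.span E"
      using fun_space.span_breakdown_eq insert.prems(2) by blast
    define g where "g = f - (\<lambda>J. k * v J)"
    have k': "g \<in> fun_space.span E"
      unfolding g_def by (rule k)
    \<comment> \<open>The remaining generators are eigenvectors, so their span is invariant under
      \<open>H\<close>.\<close>
    have inv: "H u \<in> fun_space.span E" if "u \<in> fun_space.span E" for u
      using that
    proof (induction rule: fun_space.span_induct_alt)
      case base
      show ?case
        using lin[of 0 undefined 0 undefined] fun_space.span_zero by (simp add: zero_fun_def)
    next
      case (step b w u)
      obtain d where d: "H w = (\<lambda>J. d * w J)"
        by (rule bexE[OF insert.prems(1)[OF insertI2[OF step(1)]]])
      have "H ((\<lambda>J. b * w J) + u) = (\<lambda>J. (b * d) * w J) + H u"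
      proof -
        have sum: "(\<lambda>J. b * w J) + u = (\<lambda>J. b * w J + 1 * u J)"
          by (simp add: fun_eq_iff)
        show ?thesis
          unfolding sum lin d by (rule ext) simp
      qed
      then show ?case
        by (simp only: fun_space.span_add[OF fun_space.span_scale[OF fun_space.span_base[OF step(1)]] step(2)])
    qed
    have Hg: "H g = (\<lambda>J. z * f J - k * c * v J)"
      using lin[of 1 f "- k" v] c by (simp add: g_def fun_diff_def f(2) mult.assoc)
    \<comment> \<open>The terms with \<open>v\<close> cancel in \<open>H g - c * g\<close>, which
      leaves \<open>(z - c) * f\<close>.\<close>
    have "f = (\<lambda>J. inverse (z - c) * (H g - (\<lambda>J. c * g J)) J)"
    proof
      fix J
      have "z - c \<noteq> 0"
        using z c(1) by auto
      then have "f J = inverse (z - c) * ((z - c) * f J)"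
        by simp
      then show "f J = inverse (z - c) * (H g - (\<lambda>J. c * g J)) J"
        unfolding fun_diff_def Hg by (simp add: g_def algebra_simps)
    qed
    moreover have "(\<lambda>J. inverse (z - c) * (H g - (\<lambda>J. c * g J)) J) \<in> fun_space.span E"
      by (rule fun_space.span_scale[OF fun_space.span_diff[OF inv[OF k'] fun_space.span_scale[OF k']]])
    ultimately have "f \<in> fun_space.span E"
      by metis
    then show ?case
      using insert by blast
  qed simp
  then show False
    using f(3) by (simp add: zero_fun_def)
qed


section \<open>The one-particle operator\<close>

definition sine :: "nat \<Rightarrow> nat \<Rightarrow> nat \<Rightarrow> real" where
  "sine n m z = sin (pi * real m * real z / real n)"

text \<open>The eigenvalue of \<open>sine n m\<close> for the adjacency operator of the path with
  vertices 1 to \<open>n - 1\<close>; the zeros of the sine at 0 and \<open>n\<close> are its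
  boundary conditions.\<close>

definition path_ev :: "nat \<Rightarrow> nat \<Rightarrow> real" where
  "path_ev n m = 2 * cos (pi * real m / real n)"

lemma sine_commute: "sine n m z = sine n z m"
  by (simp add: sine_def mult_ac)

lemma sine_0 [simp]: "sine n m 0 = 0"
  by (simp add: sine_def)

lemma sine_n [simp]: "sine n m n = 0"
  by (cases "n = 0") (simp_all add: sine_def sin_npi2)

lemma sine_recurrence: "sine n m (Suc (Suc z)) + sine n m z = path_ev n m * sine n m (Suc z)"
proof -
  define a where "a = pi * real m / real n"
  have sine: "sine n m z = sin (a * real z)" for z
    by (simp add: sine_def a_def)
  have "a * real (Suc (Suc z)) = a * real (Suc z) + a" "a * real z = a * real (Suc z) - a"
    by (simp_all add: algebra_simps)
  then have "sine n m (Suc (Suc z)) + sine n m z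
      = sin (a * real (Suc z) + a) + sin (a * real (Suc z) - a)"
    unfolding sine by (simp only:)
  also have "\<dots> = 2 * cos a * sin (a * real (Suc z))"
    unfolding sin_add sin_diff by simp
  finally show ?thesis
    unfolding path_ev_def a_def[symmetric] sine .
qed

lemma path_ev_inj:
  assumes "y \<le> n" "z \<le> n" "path_ev n y = path_ev n z" "n > 0"
  shows "y = z"
proof -
  have "0 \<le> pi * real x / real n \<and> pi * real x / real n \<le> pi" if "x \<le> n" for x
    using that assms(4) by (simp add: pos_divide_le_eq)
  moreover have "cos (pi * real y / real n) = cos (pi * real z / real n)"
    using assms(3) by (simp add: path_ev_def)
  ultimately have "pi * real y / real n = pi * real z / real n"
    using assms(1,2) cos_inj_pi by blast
  then show ?thesis
    using assms by simp
qed

text \<open>Discrete Green identity: by the recurrence each summand, times the difference of the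
  eigenvalues, is an increment of the Casoratian on the right.\<close>

lemma sine_wronskian:
  "(path_ev n y - path_ev n z) * (\<Sum>m=1..N. sine n y m * sine n z m)
    = sine n y (Suc N) * sine n z N - sine n y N * sine n z (Suc N)"
proof (induction N)
  case (Suc N)
  have "(path_ev n y - path_ev n z) * (\<Sum>m=1..Suc N. sine n y m * sine n z m)
      = sine n y (Suc N) * sine n z N - sine n y N * sine n z (Suc N)
        + (path_ev n y * sine n y (Suc N)) * sine n z (Suc N)
        - sine n y (Suc N) * (path_ev n z * sine n z (Suc N))"
    using Suc.IH by (simp add: algebra_simps)
  then show ?case
    unfolding sine_recurrence[symmetric] by (simp add: algebra_simps)
qed simp

text \<open>Both boundary terms of the Green identity contain a sine at \<open>N + 1\<close>, which
  is 0, while the eigenvalues differ. The symmetry of \<open>sine\<close> in its last two arguments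
  turns this into a sum over the modes.\<close>

lemma sine_orthogonal:
  assumes "y \<in> {1..N}" "z \<in> {1..N}" "y \<noteq> z"
  shows "(\<Sum>m=1..N. sine (N + 1) m y * sine (N + 1) m z) = 0"
proof -
  have "path_ev (N + 1) y \<noteq> path_ev (N + 1) z"
    using path_ev_inj[of y "N + 1" z] assms by auto
  moreover have "sine (N + 1) y (Suc N) = 0" "sine (N + 1) z (Suc N) = 0"
    using sine_n[of "N + 1"] by simp_all
  ultimately show ?thesis
    using sine_wronskian[of "N + 1" y z N] by (simp add: sine_commute[of _ _ y] sine_commute[of _ _ z])
qed

lemma sine_square_sum:
  assumes "z \<in> {1..N}"
  shows "(\<Sum>m=1..N. sine (N + 1) m z * sine (N + 1) m z) \<noteq> 0"
proof -
  \<comment> \<open>The term \<open>m = 1\<close> alone makes the sum positive, as its angle lies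
    strictly between 0 and \<open>pi\<close>.\<close>
  have "0 < sine (N + 1) 1 z"
    unfolding sine_def using assms by (intro sin_gt_zero) (auto simp: pos_divide_less_eq zero_less_divide_iff)
  then have "0 < (\<Sum>m=1..N. sine (N + 1) m z * sine (N + 1) m z)"
    using assms by (intro sum_pos2[of _ 1]) auto
  then show ?thesis by simp
qed

text \<open>Inversion of the discrete sine transform: orthogonality isolates the value at
  \<open>z\<close>, and the square sums \<open>\<nu>\<close> normalise the coefficients.\<close>

lemma sine_expansion:
  fixes g :: "nat \<Rightarrow> complex"
  shows "\<exists>c. \<forall>z\<in>{1..N}. g z = (\<Sum>m=1..N. c m * of_real (sine (N + 1) m z))"
proof -
  define S where "S m z = complex_of_real (sine (N + 1) m z)" for m z
  define \<nu> where "\<nu> z = (\<Sum>m=1..N. S m z * S m z)" for z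
  have sum: "(\<Sum>m=1..N. S m w * S m z) = of_real (\<Sum>m=1..N. sine (N + 1) m w * sine (N + 1) m z)"
    for w z by (simp add: S_def)
  have orth: "(\<Sum>m=1..N. S m w * S m z) = (if w = z then \<nu> z else 0)"
    if "w \<in> {1..N}" "z \<in> {1..N}" for w z
  proof (cases "w = z")
    case False
    then show ?thesis
      unfolding sum sine_orthogonal[OF that False] by simp
  qed (simp add: \<nu>_def)
  have nz: "\<nu> z \<noteq> 0" if "z \<in> {1..N}" for z
    using sine_square_sum[OF that] unfolding \<nu>_def sum of_real_eq_0_iff .
  define c where "c m = (\<Sum>w=1..N. g w / \<nu> w * S m w)" for m
  have "g z = (\<Sum>m=1..N. c m * S m z)" if z: "z \<in> {1..N}" for z
  proof -
    have "(\<Sum>m=1..N. c m * S m z) = (\<Sum>w=1..N. g w / \<nu> w * (\<Sum>m=1..N. S m w * S m z))"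
      unfolding c_def sum_distrib_right sum_distrib_left mult.assoc by (rule sum.swap)
    also have "\<dots> = (\<Sum>w=1..N. if w = z then g z else 0)"
      using z orth nz by (intro sum.cong) auto
    finally show ?thesis
      using z by simp
  qed
  then show ?thesis
    unfolding S_def by blast
qed

section \<open>One-particle eigenfunctions\<close>

definition mode :: "nat \<Rightarrow> complex \<Rightarrow> nat \<Rightarrow> nat \<Rightarrow> complex" where
  "mode N q m x =
    (if x \<le> N + 1 then \<Sum>z<x. qnum q z * of_real (sine (N + 1) m z) else 0)"

text \<open>At 0 and 1 the partial sum vanishes because \<open>qnum q 0 = 0\<close>; beyond
  \<open>N + 1\<close> the cut-off in the definition takes effect.\<close>

lemma mode_supp: "x \<notin> {2..N + 1} \<Longrightarrow> mode N q m x = 0"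
proof -
  assume "x \<notin> {2..N + 1}"
  then consider "x = 0" | "x = 1" | "x > N + 1" by fastforce
  then show ?thesis
    by cases (auto simp: mode_def)
qed

text \<open>Taking differences and dividing by \<open>qnum q z\<close> turns modes into sines. So
  the scaled differences of the indicator function are expanded in sines and then summed up
  again.\<close>

lemma mode_basis:
  assumes q: "\<And>p. p \<in> {1..N} \<Longrightarrow> qnum q p \<noteq> 0" and x: "x \<in> {2..N + 1}"
  shows "\<exists>c. (\<lambda>y. if y = x then 1 else 0) = (\<lambda>y. \<Sum>m=1..N. c m * mode N q m y)"
proof -
  define f :: "nat \<Rightarrow> complex" where "f y = (if y = x then 1 else 0)" for y
  define S where "S m z = complex_of_real (sine (N + 1) m z)" for m z
  obtain c where c: "(f (Suc z) - f z) / qnum q z = (\<Sum>m=1..N. c m * S m z)" if "z \<in> {1..N}" for z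
    using sine_expansion[of N "\<lambda>z. (f (Suc z) - f z) / qnum q z"] unfolding S_def by blast
  have "f y = (\<Sum>m=1..N. c m * mode N q m y)" for y
  proof (cases "y \<le> N + 1")
    case True
    have "(\<Sum>m=1..N. c m * mode N q m y) = (\<Sum>z<y. qnum q z * (\<Sum>m=1..N. c m * S m z))"
      using True unfolding mode_def S_def by (simp add: sum_distrib_left) (subst sum.swap, simp add: mult_ac)
    also have "\<dots> = (\<Sum>z<y. f (Suc z) - f z)"
    proof (rule sum.cong)
      fix z assume z: "z \<in> {..<y}"
      show "qnum q z * (\<Sum>m=1..N. c m * S m z) = f (Suc z) - f z"
      \<comment> \<open>At \<open>z = 0\<close> both sides are 0: \<open>qnum q 0\<close> vanishes,
        and \<open>f\<close> is 0 at 0 and 1 since \<open>x\<close> is at least 2.\<close>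
      proof (cases "z = 0")
        case True
        then show ?thesis using x by (simp add: f_def)
      next
        case False
        then have "z \<in> {1..N}" using z True by auto
        show ?thesis
          unfolding c[OF \<open>z \<in> {1..N}\<close>, symmetric] using q[OF \<open>z \<in> {1..N}\<close>] by simp
      qed
    qed simp
    also have "\<dots> = f y - f 0"
      by (rule sum_lessThan_telescope)
    finally show ?thesis
      using x by (simp add: f_def)
  next
    case False
    then show ?thesis
      using x by (simp add: f_def mode_def)
  qed
  then show ?thesis
    unfolding f_def by blast
qed

text \<open>The power of \<open>q\<close> is eliminated from two consecutive instances of
  \<open>qnum_Suc\<close>.\<close>

lemma qnum_recurrence:
  assumes "q \<noteq> 0"
  shows "qnum q (Suc (Suc p)) = (q + inverse q) * qnum q (Suc p) - qnum q p"
proof -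
  have "q powi (- int (Suc p)) = (qnum q (Suc p) - q * qnum q p) / q"
    using powi_Suc(2)[OF assms, of p] qnum_Suc[OF assms, of p] by simp
  then show ?thesis
    using qnum_Suc[OF assms, of "Suc p"] assms by (simp add: field_simps)
qed

section \<open>The hopping operator and its action on the modes\<close>

definition qratio :: "complex \<Rightarrow> nat \<Rightarrow> complex" where
  "qratio q p = qnum q (p + 1) / qnum q p"

text \<open>Its value 0 at \<open>p = 1\<close> means that no particle hops to 1, which is not a
  site.\<close>

definition qratio' :: "complex \<Rightarrow> nat \<Rightarrow> complex" where
  "qratio' q p = qnum q (p - 1) / qnum q p"

text \<open>The on-site term at \<open>N + 1\<close> makes up for the missing bond to the right of the last site.\<close>

definition hop :: "nat \<Rightarrow> complex \<Rightarrow> (nat set \<Rightarrow> complex) \<Rightarrow> nat set \<Rightarrow> complex" where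
  "hop N q F J = (\<Sum>p=1..N. bond p (qratio q p) (- qratio q p) (qratio' q p) (qratio q p) F J)
    + bond (N + 1) (q + inverse q) 0 0 0 F J"

definition hop1 :: "nat \<Rightarrow> complex \<Rightarrow> (nat \<Rightarrow> complex) \<Rightarrow> nat \<Rightarrow> complex" where
  "hop1 N q \<phi> x = (\<Sum>p=1..N. bond1 p (qratio q p) (- qratio q p) (qratio' q p) (qratio q p) \<phi> x)
    + bond1 (N + 1) (q + inverse q) 0 0 0 \<phi> x"

lemma hop_lincomb: "hop N q (\<lambda>J. x * F J + y * G J) = (\<lambda>J. x * hop N q F J + y * hop N q G J)"
proof -
  have "bond p e g a b (\<lambda>J. x * F J + y * G J) J = x * bond p e g a b F J + y * bond p e g a b G J"
    for p e g a b J
    by (simp add: bond_def algebra_simps)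
  then show ?thesis
    by (intro ext) (simp add: hop_def sum.distrib ring_distribs flip: sum_distrib_left)
qed

text \<open>The Leibniz rule holds for each bond, and it is inherited by sums.\<close>

lemma hop_create: "hop N q (create \<phi> F) = (\<lambda>J. create \<phi> (hop N q F) J + create (hop1 N q \<phi>) F J)"
  unfolding hop_def[abs_def] hop1_def[abs_def] bond_create create_add create_add_left create_sum
    create_sum_left sum.distrib
  by (simp add: add_ac)

lemma hop_vacuum: "hop N q (bvec {}) = (\<lambda>J. 0)"
proof
  fix J
  have "sswap p J \<noteq> {}" if "p \<in> J \<or> p + 1 \<in> J" for p
    using that by (auto simp: sswap_def)
  then have "bond p e g a b (bvec {}) J = 0" for p e g a b
    by (auto simp: bond_def bvec_def)
  then show "hop N q (bvec {}) J = 0"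
    by (simp add: hop_def)
qed

text \<open>The site \<open>Suc y\<close> is the left end of the bond \<open>Suc y\<close> and the
  right end of the bond \<open>y\<close>; the guards tell which of the two exist. The last summand
  is the on-site term.\<close>

lemma hop1_Suc:
  "hop1 N q \<phi> (Suc y) =
    (if Suc y \<le> N then qratio q (Suc y) * \<phi> (Suc y) + qratio' q (Suc y) * \<phi> (Suc (Suc y)) else 0)
    + (if y \<in> {1..N} then qratio q y * (\<phi> y - \<phi> (Suc y)) else 0)
    + (if y = N then (q + inverse q) * \<phi> (Suc y) else 0)"
proof -
  have "(\<Sum>p=1..N. bond1 p (qratio q p) (- qratio q p) (qratio' q p) (qratio q p) \<phi> (Suc y))
    = (\<Sum>p=1..N. (if p = Suc y then
          qratio q (Suc y) * \<phi> (Suc y) + qratio' q (Suc y) * \<phi> (Suc (Suc y)) else 0)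
        + (if p = y then qratio q y * (\<phi> y - \<phi> (Suc y)) else 0))"
    by (rule sum.cong) (auto simp: bond1_def algebra_simps)
  then show ?thesis
    by (auto simp: hop1_def sum.distrib bond1_def)
qed

text \<open>Both \<open>qnum q\<close> and \<open>sine n m\<close> solve a three-term recurrence, with parameters
  \<open>q + inverse q\<close> and \<open>path_ev n m\<close>, so their Casoratian telescopes. Stated without a division, as the
  two parameters may coincide.\<close>

lemma mode_wronskian:
  assumes "q \<noteq> 0"
  shows "(q + inverse q - complex_of_real (path_ev n m)) * (\<Sum>z<Suc y. qnum q z * of_real (sine n m z))
    = qnum q (Suc y) * of_real (sine n m y) - qnum q y * of_real (sine n m (Suc y))"
proof (induction y)
  case (Suc y)
  have s: "complex_of_real (sine n m (Suc (Suc y)))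
      = of_real (path_ev n m) * of_real (sine n m (Suc y)) - of_real (sine n m y)"
    unfolding of_real_mult[symmetric] sine_recurrence[symmetric] by simp
  have "(q + inverse q - complex_of_real (path_ev n m)) * (\<Sum>z<Suc (Suc y). qnum q z * of_real (sine n m z))
    = (q + inverse q - complex_of_real (path_ev n m)) * (\<Sum>z<Suc y. qnum q z * of_real (sine n m z))
    + (q + inverse q - complex_of_real (path_ev n m)) * (qnum q (Suc y) * of_real (sine n m (Suc y)))"
    unfolding sum.lessThan_Suc[of _ "Suc y"] by (rule ring_distribs(1))
  then show ?case
    unfolding Suc.IH s qnum_recurrence[OF assms] by (simp add: algebra_simps)
qed simp

text \<open>Away from the ends, the recurrence of \<open>qnum\<close> collects the multiples of
  \<open>P (Suc y)\<close> into the factor \<open>q + inverse q\<close>, and the increments of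
  \<open>P\<close> form the Casoratian, which \<open>W\<close> turns into
  \<open>q + inverse q - \<mu>\<close> times \<open>P (Suc y)\<close>.\<close>

lemma hop1_mode:
  assumes q0: "q \<noteq> 0" and q: "\<And>p. p \<in> {1..N} \<Longrightarrow> qnum q p \<noteq> 0"
  shows "hop1 N q (mode N q m) = (\<lambda>x. of_real (path_ev (N + 1) m) * mode N q m x)"
proof
  fix x
  define u where "u z = complex_of_real (sine (N + 1) m z)" for z
  define P where "P x = (\<Sum>z<x. qnum q z * u z)" for x
  define \<mu> where "\<mu> = complex_of_real (path_ev (N + 1) m)"
  have P: "mode N q m x = P x" if "x \<le> N + 1" for x
    using that by (simp add: mode_def P_def u_def)
  have P_Suc: "P (Suc x) = P x + qnum q x * u x" for x
    by (simp add: P_def)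
  have W: "(q + inverse q - \<mu>) * P (Suc y) = qnum q (Suc y) * u y - qnum q y * u (Suc y)" for y
    using mode_wronskian[OF q0] by (simp add: \<mu>_def P_def u_def)
  show "hop1 N q (mode N q m) x = of_real (path_ev (N + 1) m) * mode N q m x"
  proof (cases x)
    case 0
    then show ?thesis
      by (auto simp: hop1_def bond1_def mode_def intro!: sum.neutral)
  next
    case (Suc y)
    consider "y = 0" | "y > N" | "1 \<le> y" "y < N" | "1 \<le> y" "y = N"
      by linarith
    then show ?thesis
    proof cases
      \<comment> \<open>At 1 the mode vanishes, and its value at 2 enters with the coefficient
        \<open>qratio' q 1 = 0\<close>.\<close>
      case 1
      then show ?thesis
        using Suc by (auto simp: hop1_Suc mode_supp qratio'_def)
    next
      case 2
      then show ?thesis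
        using Suc by (auto simp: hop1_Suc mode_supp)
    next
      case 3
      have nz: "qnum q y \<noteq> 0" "qnum q (Suc y) \<noteq> 0"
        using q 3 by auto
      have "hop1 N q (mode N q m) x = (qnum q (Suc (Suc y)) + qnum q y) / qnum q (Suc y) * P (Suc y)
          + qnum q y * u (Suc y) - qnum q (Suc y) * u y"
        using nz 3 Suc by (simp add: hop1_Suc P P_Suc qratio_def qratio'_def field_simps)
      also have "\<dots> = (q + inverse q) * P (Suc y) - (q + inverse q - \<mu>) * P (Suc y)"
        using nz unfolding W qnum_recurrence[OF q0] by simp
      also have "\<dots> = \<mu> * P (Suc y)"
        by (simp add: algebra_simps)
      finally show ?thesis
        using 3 Suc by (simp add: P \<mu>_def)
    next
      case 4
      have nz: "qnum q y \<noteq> 0"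
        using q 4 by auto
      \<comment> \<open>At the last site the on-site term supplies \<open>q + inverse q\<close>, and
        this zero of the sine makes up for the term of the missing bond.\<close>
      have "u (Suc y) = 0"
        using sine_n[of "N + 1" m] 4 by (simp add: u_def)
      then have "hop1 N q (mode N q m) x = (q + inverse q) * P (Suc y) - (q + inverse q - \<mu>) * P (Suc y)"
        using nz 4 Suc unfolding W by (simp add: hop1_Suc P P_Suc qratio_def field_simps)
      also have "\<dots> = \<mu> * P (Suc y)"
        by (simp add: algebra_simps)
      finally show ?thesis
        using 4 Suc by (simp add: P \<mu>_def)
    qed
  qed
qed


section \<open>The spectrum of the Hamiltonian\<close>

text \<open>Both diagonal coefficients differ from plus or minus \<open>qratio q p\<close> by a
  scalar that depends only on whether \<open>p\<close> lies in \<open>J\<close>. What remains is a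
  bond of trace 0, as the cases with both or neither of \<open>p\<close>, \<open>p + 1\<close> in
  \<open>J\<close> require.\<close>

lemma corner_coord_bond:
  assumes "q \<noteq> 0" "qnum q p \<noteq> 0"
  shows "corner_coord q p f J = (if p \<in> J then - inverse q else q) * f J
    + bond p (qratio q p) (- qratio q p) (qratio' q p) (qratio q p) f J"
proof -
  have up: "- (q powi (- int p) / qnum q p) = q - qratio q p"
    using assms qnum_Suc[OF assms(1), of p] by (simp add: qratio_def field_simps)
  have "qnum q (Suc p) = inverse q * qnum q p + q powi int p"
    using qnum_Suc[OF assms(1), of p] qnum_diff[OF assms(1), of p] by (simp add: algebra_simps)
  then have down: "q powi int p / qnum q p = qratio q p - inverse q"
    using assms by (simp add: qratio_def field_simps)
  show ?thesis
    unfolding corner_coord_def up down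
    by (simp add: bond_def qratio_def qratio'_def algebra_simps)
qed

lemma corner_hamiltonian_hop:
  assumes adm: "corner_admissible k l q" and f: "f \<in> corner_space k l" and J: "J \<in> corner_index k l"
  shows "corner_hamiltonian k l q f J = hop (k + l) q f J"
proof -
  have q: "q \<noteq> 0" "\<And>p. p \<in> {1..k + l} \<Longrightarrow> qnum q p \<noteq> 0"
    using adm by (auto simp: corner_admissible_def)
  have JN: "J \<subseteq> {2..k + l + 1}" "card J = l"
    using J by (auto simp: corner_index_def)
  have fin: "finite J"
    using JN(1) by (rule finite_subset) simp
  \<comment> \<open>Adding the position \<open>k + l + 1\<close> makes the sum count all of
    \<open>J\<close>; subtracting it again leaves the on-site term there.\<close>
  have "(\<Sum>p=1..n. g p) = (\<Sum>p=1..n + 1. g p) - g (n + 1)" for g :: "nat \<Rightarrow> complex" and n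
    by simp
  then have "(\<Sum>p=1..k + l. if p \<in> J then - inverse q else q)
      = (\<Sum>p=1..k + l + 1. if p \<in> J then - inverse q else q) - (if k + l + 1 \<in> J then - inverse q else q)" .
  also have "(\<Sum>p=1..k + l + 1. if p \<in> J then - inverse q else q)
      = of_nat (card ({1..k + l + 1} \<inter> J)) * - inverse q + of_nat (card ({1..k + l + 1} - J)) * q"
    unfolding sum.If_cases[OF finite_atLeastAtMost] by (simp add: Diff_eq)
  also have "{1..k + l + 1} \<inter> J = J"
    using JN(1) by auto
  also have "card ({1..k + l + 1} - J) = k + 1"
    using JN fin by (subst card_Diff_subset) auto
  also have "of_nat (card J) * - inverse q + of_nat (k + 1) * q
        - (if k + l + 1 \<in> J then - inverse q else q)
      = q * of_nat k - inverse q * of_nat l + (if k + l + 1 \<in> J then q + inverse q else 0)"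
    unfolding JN(2) by (simp add: algebra_simps)
  finally have diag: "(\<Sum>p=1..k + l. if p \<in> J then - inverse q else q)
      = q * of_nat k - inverse q * of_nat l + (if k + l + 1 \<in> J then q + inverse q else 0)" .
  \<comment> \<open>The last bond thus sees at most its left end occupied.\<close>
  have "k + l + 2 \<notin> J"
    using JN(1) by auto
  then have last: "bond (k + l + 1) (q + inverse q) 0 0 0 f J
      = (if k + l + 1 \<in> J then q + inverse q else 0) * f J"
    by (simp add: bond_def)
  have "(\<Sum>p=1..k + l. corner_op k l q p f J)
      = (\<Sum>p=1..k + l. if p \<in> J then - inverse q else q) * f J
        + (\<Sum>p=1..k + l. bond p (qratio q p) (- qratio q p) (qratio' q p) (qratio q p) f J)"
    unfolding sum_distrib_right sum.distrib[symmetric]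
    using q corner_op_coord[OF f] by (intro sum.cong) (simp_all add: corner_coord_bond)
  then show ?thesis
    unfolding corner_hamiltonian_apply[OF adm f] hop_def last diag by (simp add: ring_distribs)
qed

lemma corner_hamiltonian_outside:
  assumes "corner_admissible k l q" "f \<in> corner_space k l" "J \<notin> corner_index k l"
  shows "corner_hamiltonian k l q f J = 0"
proof -
  have "corner_op k l q p f J = 0" if "p \<in> {1..k + l}" for p
    using corner_op_closed[OF that assms(2), of q] assms(3) by (simp add: corner_space_def)
  then show ?thesis
    using assms by (simp add: corner_hamiltonian_apply corner_space_def)
qed

text \<open>The products of \<open>l\<close> distinct modes are eigenvectors that span the space, so
  there are no other eigenvalues; as none of them is 0, every sum occurs.\<close>

lemma corner_spectrum:
  assumes adm: "corner_admissible k l q"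
  shows "op_spectrum (corner_space k l) (corner_hamiltonian k l q)
    = (\<lambda>M. complex_of_real (\<Sum>m\<in>M. path_ev (k + l + 1) m)) ` {M. M \<subseteq> {1..k + l} \<and> card M = l}"
    (is "_ = ?C")
proof -
  define N where "N = k + l"
  define \<phi> where "\<phi> = mode N q"
  \<comment> \<open>Unlike the Hamiltonian, which is restricted to \<open>corner_space k l\<close>,
    \<open>T\<close> is linear on all functions, as \<open>eigenvalue_of_span\<close>
    demands.\<close>
  define T where "T f J = (if J \<in> corner_index k l then hop N q f J else 0)" for f J
  let ?B = "{1..N}" and ?S = "{2..N + 1}"
  have q: "q \<noteq> 0" "\<And>p. p \<in> ?B \<Longrightarrow> qnum q p \<noteq> 0"
    using adm by (auto simp: corner_admissible_def N_def)
  have idx: "corner_index k l = {J. J \<subseteq> ?S \<and> card J = l}"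
    by (simp add: corner_index_def N_def)
  have basis: "\<exists>c. (\<lambda>y. if y = x then 1 else 0) = (\<lambda>y. \<Sum>m\<in>?B. c m * \<phi> m y)" if "x \<in> ?S" for x
    unfolding \<phi>_def by (rule mode_basis[OF q(2) that])
  have ham: "corner_hamiltonian k l q f = T f" if "f \<in> corner_space k l" for f
    using corner_hamiltonian_hop[OF adm that] corner_hamiltonian_outside[OF adm that]
    by (auto simp: T_def N_def fun_eq_iff)
  have space: "slater \<phi> (sorted_list_of_set M) \<in> corner_space k l" if "M \<subseteq> ?B" "card M = l" for M
  proof -
    have "J \<in> corner_index k l" if "slater \<phi> (sorted_list_of_set M) J \<noteq> 0" for J
    proof -
      have "J \<subseteq> ?S \<and> card J = length (sorted_list_of_set M) \<and> finite J"
        using that by (rule slater_supp[rotated]) (auto simp: \<phi>_def mode_supp)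
      then show ?thesis
        using \<open>card M = l\<close> by (simp add: idx)
    qed
    then show ?thesis
      by (auto simp: corner_space_def)
  qed
  have eig: "T (slater \<phi> (sorted_list_of_set M))
      = (\<lambda>J. of_real (\<Sum>m\<in>M. path_ev (N + 1) m) * slater \<phi> (sorted_list_of_set M) J)"
    if M: "M \<subseteq> ?B" "card M = l" for M
  proof -
    have "finite M"
      using M(1) by (rule finite_subset) simp
    then have "sum_list (map (\<lambda>m. complex_of_real (path_ev (N + 1) m)) (sorted_list_of_set M))
        = of_real (\<Sum>m\<in>M. path_ev (N + 1) m)"
      by (simp add: sum_list_distinct_conv_sum_set)
    moreover have "hop N q (slater \<phi> (sorted_list_of_set M))
        = (\<lambda>J. sum_list (map (\<lambda>m. complex_of_real (path_ev (N + 1) m)) (sorted_list_of_set M))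
            * slater \<phi> (sorted_list_of_set M) J)"
      by (rule slater_eigen[OF hop_create hop_vacuum]) (unfold \<phi>_def, rule hop1_mode[OF q])
    ultimately show ?thesis
      using space[OF M] by (auto simp: T_def corner_space_def fun_eq_iff)
  qed
  have C: "?C = (\<lambda>M. complex_of_real (\<Sum>m\<in>M. path_ev (N + 1) m)) ` {M. M \<subseteq> ?B \<and> card M = l}"
    by (simp add: N_def)
  show ?thesis
  proof (intro subset_antisym subsetI)
    fix z assume "z \<in> op_spectrum (corner_space k l) (corner_hamiltonian k l q)"
    then obtain f where f: "f \<in> corner_space k l" "f \<noteq> (\<lambda>J. 0)" "corner_hamiltonian k l q f = (\<lambda>J. z * f J)"
      by (auto simp: op_spectrum_def)
    have "f = (\<Sum>J\<in>corner_index k l. (\<lambda>I. f J * bvec J I))"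
    proof
      fix I
      have "(\<Sum>J\<in>corner_index k l. f J * bvec J I) = (\<Sum>J\<in>corner_index k l. if J = I then f I else 0)"
        by (intro sum.cong) (auto simp: bvec_def)
      then show "f I = (\<Sum>J\<in>corner_index k l. (\<lambda>I. f J * bvec J I)) I"
        unfolding sum_fun_apply using f(1) finite_corner_index[of k l] by (simp add: corner_space_def)
    qed
    also have "\<dots> \<in> fun_space.span (slater_sets \<phi> ?B l)"
    proof (intro fun_space.span_sum fun_space.span_scale)
      fix J assume "J \<in> corner_index k l"
      then show "bvec J \<in> fun_space.span (slater_sets \<phi> ?B l)"
        using bvec_in_span[of ?B ?S, OF _ _ basis] by (simp add: idx)
    qed
    finally have span: "f \<in> fun_space.span (slater_sets \<phi> ?B l)" .
    have "finite {M. M \<subseteq> ?B \<and> card M = l}"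
      by simp
    then have "finite (slater_sets \<phi> ?B l)"
      unfolding slater_sets_def by (rule finite_imageI)
    moreover have "T (\<lambda>J. x * f J + y * g J) = (\<lambda>J. x * T f J + y * T g J)" for x y f g
      by (auto simp: T_def hop_lincomb fun_eq_iff)
    moreover have "\<exists>c\<in>?C. T v = (\<lambda>J. c * v J)" if "v \<in> slater_sets \<phi> ?B l" for v
    proof -
      obtain M where "M \<subseteq> ?B" "card M = l" "v = slater \<phi> (sorted_list_of_set M)"
        using \<open>v \<in> slater_sets \<phi> ?B l\<close> unfolding slater_sets_def by blast
      then show ?thesis
        unfolding C using eig[of M] by blast
    qed
    moreover have "T f = (\<lambda>J. z * f J)"
      using f ham by simp
    ultimately show "z \<in> ?C"
      using span f(2) by (intro eigenvalue_of_span[of "slater_sets \<phi> ?B l" T])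
  next
    fix z assume "z \<in> ?C"
    then obtain M where M: "M \<subseteq> ?B" "card M = l" "z = of_real (\<Sum>m\<in>M. path_ev (N + 1) m)"
      unfolding C by blast
    let ?v = "slater \<phi> (sorted_list_of_set M)"
    have "?v \<noteq> (\<lambda>J. 0)"
      by (rule slater_nonzero[of ?B ?S]) (use basis M in auto)
    moreover have "corner_hamiltonian k l q ?v = (\<lambda>J. z * ?v J)"
      using ham[OF space[OF M(1,2)]] eig[OF M(1,2)] M(3) by simp
    ultimately show "z \<in> op_spectrum (corner_space k l) (corner_hamiltonian k l q)"
      using space[OF M(1,2)] unfolding op_spectrum_def by blast
  qed
qed

section \<open>From subsets to increasing integer sequences\<close>

lemma subset_sums_eq_strict_mono_sums:
  fixes g :: "int \<Rightarrow> 'a :: comm_monoid_add"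
  shows "(\<lambda>M. \<Sum>m\<in>M. g (int m)) ` {M. M \<subseteq> {1..N} \<and> card M = l}
    = {\<Sum>i=1..l. g (m i) | m. strict_mono_on {1..l} m \<and> (\<forall>i\<in>{1..l}. 1 \<le> m i \<and> m i \<le> int N)}"
proof (intro subset_antisym subsetI)
  fix s assume "s \<in> (\<lambda>M. \<Sum>m\<in>M. g (int m)) ` {M. M \<subseteq> {1..N} \<and> card M = l}"
  then obtain M where M: "M \<subseteq> {1..N}" "card M = l" "s = (\<Sum>m\<in>M. g (int m))"
    by blast
  have "finite M"
    using M(1) by (rule finite_subset) simp
  then obtain h where h: "bij_betw h {..<l} M" "strict_mono_on {..<l} h"
    using ex_bij_betw_strict_mono_card[of M] M(2) by auto
  have "s = (\<Sum>i<l. g (int (h i)))"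
    unfolding M(3) by (rule sum.reindex_bij_betw[OF h(1), symmetric])
  \<comment> \<open>The increasing enumeration \<open>h\<close> of \<open>M\<close> starts at index
    0, the sequences \<open>m\<close> at index 1.\<close>
  also have "\<dots> = (\<Sum>i=1..l. g (int (h (i - 1))))"
    by (rule sum.reindex_bij_witness[of _ "\<lambda>i. i - 1" Suc]) auto
  finally have "s = (\<Sum>i=1..l. g (int (h (i - 1))))" .
  moreover have "strict_mono_on {1..l} (\<lambda>i. int (h (i - 1)))"
    by (rule strict_mono_onI) (auto intro!: strict_mono_onD[OF h(2)])
  moreover have "1 \<le> int (h (i - 1)) \<and> int (h (i - 1)) \<le> int N" if "i \<in> {1..l}" for i
  proof -
    have "h (i - 1) \<in> M"
      using bij_betwE[OF h(1)] that by auto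
    then show ?thesis
      using M(1) by auto
  qed
  ultimately show "s \<in> {\<Sum>i=1..l. g (m i) | m. strict_mono_on {1..l} m \<and> (\<forall>i\<in>{1..l}. 1 \<le> m i \<and> m i \<le> int N)}"
    by (intro CollectI exI[of _ "\<lambda>i. int (h (i - 1))"] conjI ballI) auto
next
  fix s
  assume "s \<in> {\<Sum>i=1..l. g (m i) | m. strict_mono_on {1..l} m \<and> (\<forall>i\<in>{1..l}. 1 \<le> m i \<and> m i \<le> int N)}"
  then obtain m where m: "strict_mono_on {1..l} m" "\<And>i. i \<in> {1..l} \<Longrightarrow> 1 \<le> m i \<and> m i \<le> int N"
    "s = (\<Sum>i=1..l. g (m i))"
    by blast
  define M where "M = (\<lambda>i. nat (m i)) ` {1..l}"
  have inj: "inj_on (\<lambda>i. nat (m i)) {1..l}"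
  proof (rule inj_onI)
    fix i j assume ij: "i \<in> {1..l}" "j \<in> {1..l}" "nat (m i) = nat (m j)"
    then have "m i = m j"
      using m(2)[of i] m(2)[of j] by auto
    then show "i = j"
      using strict_mono_on_imp_inj_on[OF m(1)] ij by (auto dest: inj_onD)
  qed
  have "M \<subseteq> {1..N}"
    using m(2) by (force simp: M_def)
  moreover have "card M = l"
    using card_image[OF inj] by (simp add: M_def)
  moreover have "s = (\<Sum>m\<in>M. g (int m))"
  proof -
    have "int (nat (m i)) = m i" if "i \<in> {1..l}" for i
      using m(2)[OF that] by simp
    then show ?thesis
      unfolding M_def m(3) sum.reindex[OF inj] by (auto intro!: sum.cong)
  qed
  ultimately show "s \<in> (\<lambda>M. \<Sum>m\<in>M. g (int m)) ` {M. M \<subseteq> {1..N} \<and> card M = l}"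
    by blast
qed

theorem theorem4p1:
  fixes k l :: nat
  assumes "l \<ge> 1"
  shows "(\<forall>q q'. corner_admissible k l q \<and> corner_admissible k l q' \<longrightarrow>
           op_spectrum (corner_space k l) (corner_hamiltonian k l q)
           = op_spectrum (corner_space k l) (corner_hamiltonian k l q'))
       \<and> (\<forall>q. corner_admissible k l q \<longrightarrow>
           op_spectrum (corner_space k l) (corner_hamiltonian k l q)
           = {complex_of_real (\<Sum>i=1..l. 2 * cos (pi * real_of_int (m i) / real (k + l + 1))) |
                m :: nat \<Rightarrow> int.
                strict_mono_on {1..l} m \<and> (\<forall>i\<in>{1..l}. 1 \<le> m i \<and> m i \<le> int (k + l))})"
proof -
  define g where "g m = 2 * cos (pi * real_of_int m / real (k + l + 1))" for m
  have "(\<lambda>M. complex_of_real (\<Sum>m\<in>M. path_ev (k + l + 1) m)) ` {M. M \<subseteq> {1..k + l} \<and> card M = l}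
      = complex_of_real ` (\<lambda>M. \<Sum>m\<in>M. g (int m)) ` {M. M \<subseteq> {1..k + l} \<and> card M = l}"
    unfolding image_image by (simp only: path_ev_def g_def of_int_of_nat_eq)
  also have "\<dots> = {complex_of_real (\<Sum>i=1..l. g (m i)) |
      m. strict_mono_on {1..l} m \<and> (\<forall>i\<in>{1..l}. 1 \<le> m i \<and> m i \<le> int (k + l))}"
    unfolding subset_sums_eq_strict_mono_sums by blast
  \<comment> \<open>The set found is free of \<open>q\<close>, which also gives
    isospectrality.\<close>
  finally show ?thesis
    unfolding g_def using corner_spectrum by simp
qed

end
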